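(* There exists a non-adaptive tester for $k$-monotonicity of functions $f\colon[n]^d\to\{0,1\}$ with query complexity $q(n,d,\varepsilon,k)=\min\left(\tilde{O}\!\left(\frac{1}{\varepsilon^2}\left(\frac{5kd}{\varepsilon}\right)^d\right),\ 2^{\tilde{O}(k\sqrt{d}/\varepsilon^2)}\right)$.
   Context: $[n]^d$ is ordered coordinatewise. A function $f\colon[n]^d\to\{0,1\}$ is $k$-monotone if there do not exist $x_1\preceq\cdots\preceq x_{k+1}$ with $f(x_1)=1$ and $f(x_i)\neq f(x_{i+1})$ for all $i\in[k]$. Distance is normalized Hamming distance $\Pr_x[f(x)\neq g(x)]$ over uniform $x\in[n]^d$. A tester, given $\varepsilon$ and query access to $f$, accepts $k$-monotone $f$ with probability at least $2/3$ and rejects $f$ that is $\varepsilon$-far from $k$-monotone with probability at least $2/3$; non-adaptive means queries do not depend on previous answers. $\tilde{O}$ hides polylogarithmic factors. *)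

theory Defs
  imports "HOL-Probability.Probability"
begin

text \<open>Points of [n]^d are lists of length d with entries in {0..<n}
  (we index [n] as {0,...,n-1}; this is just a relabelling).
  Boolean functions f : [n]^d -> {0,1} are modelled as nat list => bool
  (True = 1); only their values on the grid matter.\<close>

definition grid :: "nat \<Rightarrow> nat \<Rightarrow> nat list set" where
  "grid n d = {x. length x = d \<and> (\<forall>i<d. x ! i < n)}"

definition coord_le :: "nat list \<Rightarrow> nat list \<Rightarrow> bool" where
  "coord_le x y \<longleftrightarrow> length x = length y \<and> (\<forall>i<length x. x ! i \<le> y ! i)"

definition k_monotone :: "nat \<Rightarrow> nat \<Rightarrow> nat \<Rightarrow> (nat list \<Rightarrow> bool) \<Rightarrow> bool" where
  "k_monotone n d k f \<longleftrightarrow>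
     \<not> (\<exists>c :: nat \<Rightarrow> nat list.
          (\<forall>i\<le>k. c i \<in> grid n d) \<and>
          (\<forall>i<k. coord_le (c i) (c (Suc i))) \<and>
          f (c 0) \<and>
          (\<forall>i<k. f (c i) \<noteq> f (c (Suc i))))"

definition hdist :: "nat \<Rightarrow> nat \<Rightarrow> (nat list \<Rightarrow> bool) \<Rightarrow> (nat list \<Rightarrow> bool) \<Rightarrow> real" where
  "hdist n d f g = real (card {x \<in> grid n d. f x \<noteq> g x}) / real (card (grid n d))"

definition eps_far_k_monotone ::
  "nat \<Rightarrow> nat \<Rightarrow> nat \<Rightarrow> real \<Rightarrow> (nat list \<Rightarrow> bool) \<Rightarrow> bool" where
  "eps_far_k_monotone n d k \<epsilon> f \<longleftrightarrow> (\<forall>g. k_monotone n d k g \<longrightarrow> hdist n d f g \<ge> \<epsilon>)"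

text \<open>A non-adaptive randomized tester: a probability distribution over pairs
  (queries, decision), where queries is a list of grid points fixed in advance
  (independently of the answers) and decision maps the list of answers to
  accept (True) / reject (False).\<close>

type_synonym na_tester = "(nat list list \<times> (bool list \<Rightarrow> bool)) pmf"

definition accept_prob :: "na_tester \<Rightarrow> (nat list \<Rightarrow> bool) \<Rightarrow> real" where
  "accept_prob T f = measure_pmf.prob T {(qs, dec). dec (map f qs)}"

definition is_kmon_tester ::
  "nat \<Rightarrow> nat \<Rightarrow> nat \<Rightarrow> real \<Rightarrow> na_tester \<Rightarrow> bool" where
  "is_kmon_tester n d k \<epsilon> T \<longleftrightarrow>
     (\<forall>(qs, dec) \<in> set_pmf T. set qs \<subseteq> grid n d) \<and>
     (\<forall>f. k_monotone n d k f \<longrightarrow> accept_prob T f \<ge> 2/3) \<and>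
     (\<forall>f. eps_far_k_monotone n d k \<epsilon> f \<longrightarrow> 1 - accept_prob T f \<ge> 2/3)"

definition max_queries :: "na_tester \<Rightarrow> real \<Rightarrow> bool" where
  "max_queries T q \<longleftrightarrow> (\<forall>(qs, dec) \<in> set_pmf T. real (length qs) \<le> q)"

definition soft_O :: "real \<Rightarrow> nat \<Rightarrow> real \<Rightarrow> real" where
  "soft_O C c g = C * g * (log 2 (2 + g)) ^ c"

end

theory Submission
  imports Defs
begin

text \<open>
  A \<open>k\<close>-monotone function is the parity of a monotone function into \<open>{0..k}\<close>, namely
  the number of alternations that a chain below a point can achieve. To test, it suffices to
  attach to every \<open>k\<close>-monotone function a signature with few possible values such that functions
  of equal signature are \<open>\<epsilon>/2\<close>-close: one representative per signature forms a cover, and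
  comparing \<open>f\<close> with all of these on one common uniform sample decides by Hoeffding's inequality
  and a union bound, with a number of samples logarithmic in the number of signatures.

  For the first bound the signature consists of the values at the corners of a coarse partition
  into blocks. For the second one, the coarsened function is pulled back to the cube
  \<open>{0,1}^(dR)\<close> by writing the block indices in binary, which preserves monotonicity. There
  the total influence of the parity of a monotone function \<open>H\<close> is at most that of \<open>H\<close>, hence
  of order \<open>k\<close> times the square root of \<open>dR\<close>, so the function is determined up to a small error
  by its low-degree Fourier coefficients; these, suitably rounded, form the signature.
\<close>

section \<open>Level functions of k-monotone functions\<close>

lemma grid_eq_lists: "grid n d = {x. set x \<subseteq> {..<n} \<and> length x = d}"
  by (auto simp: grid_def subset_iff in_set_conv_nth)

lemma finite_grid [simp]: "finite (grid n d)"
  unfolding grid_eq_lists by (rule finite_lists_length_eq) simp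

lemma card_grid: "card (grid n d) = n ^ d"
  unfolding grid_eq_lists by (subst card_lists_length_eq) auto

lemma coord_le_refl [simp]: "coord_le x x"
  by (simp add: coord_le_def)

lemma coord_le_trans: "coord_le x y \<Longrightarrow> coord_le y z \<Longrightarrow> coord_le x z"
  unfolding coord_le_def by (metis order_trans)

lemma map_in_grid:
  assumes "x \<in> grid n d" "\<And>a. a < n \<Longrightarrow> \<phi> a < m"
  shows "map \<phi> x \<in> grid m d"
  using assms by (auto simp: grid_def)

lemma coord_le_map: "coord_le x y \<Longrightarrow> mono \<phi> \<Longrightarrow> coord_le (map \<phi> x) (map \<phi> y)"
  by (auto simp: coord_le_def monoD)

definition level_function :: "nat \<Rightarrow> nat \<Rightarrow> nat \<Rightarrow> (nat list \<Rightarrow> nat) \<Rightarrow> bool" where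
  "level_function n d k h \<longleftrightarrow>
     (\<forall>x\<in>grid n d. h x \<le> k) \<and>
     (\<forall>x\<in>grid n d. \<forall>y\<in>grid n d. coord_le x y \<longrightarrow> h x \<le> h y)"

text \<open>Some chain that starts with value 1 and ends below \<open>x\<close> has \<open>l\<close> points of alternating values.\<close>

inductive alternates :: "nat \<Rightarrow> nat \<Rightarrow> (nat list \<Rightarrow> bool) \<Rightarrow> nat list \<Rightarrow> nat \<Rightarrow> bool"
  for n d f where
  zero: "x \<in> grid n d \<Longrightarrow> alternates n d f x 0"
| up: "alternates n d f y l \<Longrightarrow> x \<in> grid n d \<Longrightarrow> coord_le y x \<Longrightarrow> alternates n d f x l"
| step: "alternates n d f x l \<Longrightarrow> f x = even l \<Longrightarrow> alternates n d f x (Suc l)"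

text \<open>Produces a chain in the form that \<open>k_monotone\<close> speaks of: \<open>up\<close>
  keeps the chain of the lower point, and \<open>step\<close> appends the endpoint itself as
  \<open>c l\<close>.\<close>

lemma alternates_chain:
  assumes "alternates n d f x l"
  shows "x \<in> grid n d \<and> (\<exists>c. (\<forall>i<l. c i \<in> grid n d \<and> coord_le (c i) x \<and> f (c i) = even i) \<and>
           (\<forall>i. Suc i < l \<longrightarrow> coord_le (c i) (c (Suc i))))"
  using assms
proof induction
  case (zero x)
  then show ?case by simp
next
  case (up y l x)
  then obtain c where c: "\<forall>i<l. c i \<in> grid n d \<and> coord_le (c i) y \<and> f (c i) = even i"
    "\<forall>i. Suc i < l \<longrightarrow> coord_le (c i) (c (Suc i))" by blast
  have "\<forall>i<l. c i \<in> grid n d \<and> coord_le (c i) x \<and> f (c i) = even i"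
    using c(1) coord_le_trans[OF _ up.hyps(3)] by blast
  with c(2) up.hyps show ?case by blast
next
  case (step x l)
  then obtain c where c: "\<forall>i<l. c i \<in> grid n d \<and> coord_le (c i) x \<and> f (c i) = even i"
    "\<forall>i. Suc i < l \<longrightarrow> coord_le (c i) (c (Suc i))" by blast
  have "(\<forall>i<Suc l. (c(l := x)) i \<in> grid n d \<and> coord_le ((c(l := x)) i) x \<and> f ((c(l := x)) i) = even i) \<and>
        (\<forall>i. Suc i < Suc l \<longrightarrow> coord_le ((c(l := x)) i) ((c(l := x)) (Suc i)))"
    using c step by (auto simp: less_Suc_eq)
  with step show ?case by blast
qed

lemma alternates_le:
  assumes "k_monotone n d k f" "alternates n d f x l"
  shows "l \<le> k"
proof (rule ccontr)
  assume "\<not> l \<le> k"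
  obtain c where c: "\<forall>i<l. c i \<in> grid n d \<and> coord_le (c i) x \<and> f (c i) = even i"
    "\<forall>i. Suc i < l \<longrightarrow> coord_le (c i) (c (Suc i))"
    using alternates_chain[OF assms(2)] by blast
  \<comment> \<open>Since \<open>l > k\<close>, the points \<open>c 0\<close>, ...,
    \<open>c k\<close> all exist and are already a forbidden pattern.\<close>
  have "(\<forall>i\<le>k. c i \<in> grid n d) \<and> (\<forall>i<k. coord_le (c i) (c (Suc i))) \<and> f (c 0) \<and>
        (\<forall>i<k. f (c i) \<noteq> f (c (Suc i)))"
    using c \<open>\<not> l \<le> k\<close> by auto
  with assms(1) show False
    unfolding k_monotone_def by blast
qed

lemma k_monotone_imp_parity:
  assumes "k_monotone n d k f"
  obtains h where "level_function n d k h" "\<And>x. x \<in> grid n d \<Longrightarrow> f x \<longleftrightarrow> odd (h x)"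
proof
  \<comment> \<open>On the grid this maximum exists: \<open>zero\<close> makes the set nonempty and
    \<open>alternates_le\<close> bounds it by \<open>k\<close>.\<close>
  define h where "h x = Max {l. alternates n d f x l}" for x
  have sub: "{l. alternates n d f x l} \<subseteq> {..k}" for x
    using alternates_le[OF assms] by auto
  have fin: "finite {l. alternates n d f x l}" for x
    using finite_subset[OF sub] by simp
  have alt: "alternates n d f x (h x)" if "x \<in> grid n d" for x
    using Max_in[OF fin, of x] alternates.zero[OF that, of f] unfolding h_def by auto
  have ge: "l \<le> h x" if "alternates n d f x l" for x l
    using Max_ge[OF fin, of l x] that unfolding h_def by auto
  show "level_function n d k h"
    unfolding level_function_def using alt ge alternates_le[OF assms] alternates.up by meson
  fix x assume x: "x \<in> grid n d"
  \<comment> \<open>By maximality \<open>step\<close> cannot apply at \<open>x\<close>, so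
    \<open>f x\<close> differs from \<open>even (h x)\<close>.\<close>
  have "\<not> alternates n d f x (Suc (h x))"
    using ge[of x "Suc (h x)"] by auto
  then show "f x \<longleftrightarrow> odd (h x)"
    using alternates.step alt[OF x] by blast
qed

section \<open>Normalized Hamming distance as a pseudometric\<close>

lemma hdist_triangle: "hdist n d f g \<le> hdist n d f h + hdist n d h g"
proof -
  have "card {x \<in> grid n d. f x \<noteq> g x} \<le>
        card ({x \<in> grid n d. f x \<noteq> h x} \<union> {x \<in> grid n d. h x \<noteq> g x})"
    by (rule card_mono) auto
  also have "\<dots> \<le> card {x \<in> grid n d. f x \<noteq> h x} + card {x \<in> grid n d. h x \<noteq> g x}"
    by (rule card_Un_le)
  finally show ?thesis
    unfolding hdist_def add_divide_distrib[symmetric]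
    by (intro divide_right_mono) (simp_all flip: of_nat_add)
qed

lemma hdist_commute: "hdist n d f g = hdist n d g f"
  unfolding hdist_def by (metis (mono_tags, lifting))

section \<open>Rounding to block corners\<close>

definition round_down :: "nat \<Rightarrow> nat list \<Rightarrow> nat list" where
  "round_down B = map (\<lambda>a. B * (a div B))"

lemma round_down_in_grid: "x \<in> grid n d \<Longrightarrow> round_down B x \<in> grid n d"
  unfolding round_down_def by (rule map_in_grid) (auto intro: le_less_trans[OF times_div_less_eq_dividend])

text \<open>Coordinate \<open>i\<close> has at most \<open>c\<close> admissible values and the
  others are free. The factor \<open>n\<close> on the left avoids the exponent
  \<open>d - 1\<close>.\<close>

lemma card_grid_coord_ge:
  assumes "i < d"
  shows "card {x \<in> grid n d. n - c \<le> x ! i} * n \<le> c * n ^ d"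
proof -
  obtain e where e: "d = Suc e" using assms by (cases d) auto
  let ?S = "{x \<in> grid n d. n - c \<le> x ! i}"
  let ?g = "\<lambda>x. (x ! i, take i x @ drop (Suc i) x)"
  have "inj_on ?g ?S"
  proof (rule inj_onI)
    fix x y assume xy: "x \<in> ?S" "y \<in> ?S" and eq: "?g x = ?g y"
    have "take i x = take i y" "drop (Suc i) x = drop (Suc i) y"
      using xy eq assms by (auto simp: grid_def append_eq_append_conv)
    then show "x = y"
      using eq xy assms id_take_nth_drop[of i x] id_take_nth_drop[of i y] by (auto simp: grid_def)
  qed
  moreover have "?g ` ?S \<subseteq> {n - c..<n} \<times> grid n e"
    using assms e
    by (auto simp: grid_eq_lists subset_iff dest!: in_set_takeD in_set_dropD)
  ultimately have "card ?S \<le> card ({n - c..<n} \<times> grid n e)"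
    by (intro card_inj_on_le) auto
  also have "\<dots> = (n - (n - c)) * n ^ e"
    by (simp add: card_cartesian_product card_grid)
  also have "\<dots> \<le> c * n ^ e"
    by (intro mult_le_mono1) arith
  finally show ?thesis
    by (simp add: e mult.assoc mult.left_commute[of n])
qed

text \<open>Rounding moves a point down by at most \<open>B - 1\<close> in each coordinate, so the sum of the
  level function over the grid drops by at most what the translation by \<open>B - 1\<close> loses at the
  upper faces.\<close>

lemma sum_level_round_down:
  assumes h: "level_function n d k h" and B: "B \<ge> 1"
  shows "(\<Sum>x\<in>grid n d. h x) * n \<le> (\<Sum>x\<in>grid n d. h (round_down B x)) * n + k * d * (B - 1) * n ^ d"
proof -
  define c where "c = B - 1"
  \<comment> \<open>The points that stay in the grid when all coordinates are shifted up by
    \<open>c\<close>; the rest is covered by \<open>d\<close> upper faces of thickness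
    \<open>c\<close>.\<close>
  define L where "L = {x \<in> grid n d. \<forall>i<d. x ! i < n - c}"
  have L: "L \<subseteq> grid n d" "finite L"
    by (auto simp: L_def intro: finite_subset[OF _ finite_grid])
  let ?sh = "map (\<lambda>a. a + c)"
  have sh: "?sh x \<in> grid n d" if "x \<in> L" for x
    using that by (auto simp: L_def grid_def)
  have "(\<Sum>x\<in>L. h x) \<le> (\<Sum>x\<in>L. h (round_down B (?sh x)))"
  proof (rule sum_mono)
    fix x assume x: "x \<in> L"
    have "a \<le> B * ((a + c) div B)" for a
    proof -
      have "a + c = B * ((a + c) div B) + (a + c) mod B" by simp
      moreover have "(a + c) mod B \<le> c"
        using mod_less_divisor[of B "a + c"] B unfolding c_def by linarith
      ultimately show ?thesis by linarith
    qed
    \<comment> \<open>Rounding loses at most \<open>c\<close>, so it cannot bring the shifted point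
      below \<open>x\<close>.\<close>
    then have "coord_le x (round_down B (?sh x))"
      by (auto simp: coord_le_def round_down_def)
    then show "h x \<le> h (round_down B (?sh x))"
      using h x sh[OF x] L round_down_in_grid unfolding level_function_def by blast
  qed
  also have "\<dots> = (\<Sum>x\<in>?sh ` L. h (round_down B x))"
    by (subst sum.reindex) (auto intro!: inj_on_subset[OF inj_mapI] injI)
  also have "\<dots> \<le> (\<Sum>x\<in>grid n d. h (round_down B x))"
    using sh by (intro sum_mono2) auto
  finally have 1: "(\<Sum>x\<in>L. h x) \<le> (\<Sum>x\<in>grid n d. h (round_down B x))" .
  have "(\<Sum>x\<in>grid n d - L. h x) \<le> card (grid n d - L) * k"
    using h sum_bounded_above[of "grid n d - L" h k] by (auto simp: level_function_def)
  then have "(\<Sum>x\<in>grid n d - L. h x) * n \<le> card (grid n d - L) * n * k"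
    by (metis mult.assoc mult.commute mult_le_mono1)
  also have "card (grid n d - L) * n \<le> (\<Sum>i<d. card {x \<in> grid n d. n - c \<le> x ! i}) * n"
  proof -
    have "grid n d - L = (\<Union>i<d. {x \<in> grid n d. n - c \<le> x ! i})"
      by (auto simp: L_def not_less)
    then show ?thesis using card_UN_le[of "{..<d}"] by auto
  qed
  also have "\<dots> \<le> (\<Sum>i<d. c * n ^ d)"
    unfolding sum_distrib_right by (intro sum_mono card_grid_coord_ge) auto
  finally have 2: "(\<Sum>x\<in>grid n d - L. h x) * n \<le> k * d * c * n ^ d"
    by (simp add: mult_ac)
  have "(\<Sum>x\<in>grid n d. h x) = (\<Sum>x\<in>grid n d - L. h x) + (\<Sum>x\<in>L. h x)"
    using L by (intro sum.subset_diff) auto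
  then have "(\<Sum>x\<in>grid n d. h x) * n = (\<Sum>x\<in>grid n d - L. h x) * n + (\<Sum>x\<in>L. h x) * n"
    by (simp add: add_mult_distrib)
  with mult_le_mono1[OF 1, of n] 2 show ?thesis
    unfolding c_def[symmetric] by linarith
qed

text \<open>Rounding never raises the level \<open>h\<close>, and wherever it changes the parity,
  \<open>h\<close> drops by at least 1. The number of changed points is thus at most the total drop
  of \<open>h\<close>.\<close>

lemma hdist_round_down:
  assumes f: "k_monotone n d k f" and B: "B \<ge> 1" and n: "n \<ge> 1"
  shows "hdist n d f (f \<circ> round_down B) \<le> real k * real d * real (B - 1) / real n"
proof -
  obtain h where h: "level_function n d k h" "\<And>x. x \<in> grid n d \<Longrightarrow> f x \<longleftrightarrow> odd (h x)"
    using k_monotone_imp_parity[OF f] by blast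
  let ?D = "{x \<in> grid n d. f x \<noteq> (f \<circ> round_down B) x}"
  have le: "h (round_down B x) \<le> h x" if "x \<in> grid n d" for x
  proof -
    have "coord_le (round_down B x) x"
      by (auto simp: coord_le_def round_down_def)
    then show ?thesis
      using h(1) that round_down_in_grid unfolding level_function_def by blast
  qed
  have "card ?D + (\<Sum>x\<in>grid n d. h (round_down B x)) =
        (\<Sum>x\<in>grid n d. (if f x \<noteq> (f \<circ> round_down B) x then 1 else 0) + h (round_down B x))"
    unfolding sum.distrib by (simp add: sum.If_cases Int_def)
  also have "\<dots> \<le> (\<Sum>x\<in>grid n d. h x)"
  proof (rule sum_mono)
    fix x assume x: "x \<in> grid n d"
    show "(if f x \<noteq> (f \<circ> round_down B) x then 1 else 0) + h (round_down B x) \<le> h x"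
      using le[OF x] h(2)[OF x] h(2)[OF round_down_in_grid[OF x, of B]]
      by (cases "h (round_down B x) = h x") auto
  qed
  finally have "card ?D * n + (\<Sum>x\<in>grid n d. h (round_down B x)) * n \<le> (\<Sum>x\<in>grid n d. h x) * n"
    by (metis add_mult_distrib mult_le_mono1)
  with sum_level_round_down[OF h(1) B] have "card ?D * n \<le> k * d * (B - 1) * n ^ d"
    by linarith
  then have "real (card ?D) * real n \<le> real k * real d * real (B - 1) * real n ^ d"
    by (simp flip: of_nat_mult of_nat_power)
  then show ?thesis
    using n unfolding hdist_def card_grid by (simp add: field_simps)
qed

section \<open>Testing from a signature\<close>

lemma map_replicate_pmf: "replicate_pmf q (map_pmf g p) = map_pmf (map g) (replicate_pmf q p)"
  by (induction q) (simp_all add: map_bind_pmf bind_map_pmf)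

lemma map_pmf_eq_bernoulli: "map_pmf P p = bernoulli_pmf (measure_pmf.prob p {x. P x})"
proof (rule pmf_eqI)
  fix b :: bool
  have compl: "measure_pmf.prob p {x. \<not> P x} = 1 - measure_pmf.prob p {x. P x}"
    using measure_pmf.prob_compl[of "{x. P x}" p] by (simp add: Compl_eq_Diff_UNIV[symmetric] Collect_neg_eq)
  show "pmf (map_pmf P p) b = pmf (bernoulli_pmf (measure_pmf.prob p {x. P x})) b"
    by (cases b) (simp_all add: pmf_map vimage_def compl)
qed

text \<open>Applying \<open>P\<close> to each draw gives independent Bernoulli variables; the count
  is binomial, which makes Hoeffding's inequality available.\<close>

lemma count_replicate_pmf:
  "map_pmf (\<lambda>xs. length (filter P xs)) (replicate_pmf q p) =
   binomial_pmf q (measure_pmf.prob p {x. P x})"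
  by (subst binomial_pmf_altdef)
     (simp_all add: map_pmf_eq_bernoulli[symmetric] map_replicate_pmf map_pmf_comp o_def filter_map)

section \<open>Estimating distances from a common sample\<close>

definition disagreements :: "('a \<Rightarrow> bool) \<Rightarrow> ('a \<Rightarrow> bool) \<Rightarrow> 'a list \<Rightarrow> nat" where
  "disagreements f g xs = length (filter (\<lambda>x. f x \<noteq> g x) xs)"

text \<open>The decision may depend on \<open>f\<close> only through the answers; paired with the
  query points, they suffice to count disagreements with a known \<open>g\<close>.\<close>

lemma disagreements_zip:
  "length (filter (\<lambda>p. fst p \<noteq> g (snd p)) (zip (map f xs) xs)) = disagreements f g xs"
  by (induction xs) (auto simp: disagreements_def)

context
  fixes n d q :: nat and S :: "nat list list pmf"
  assumes n: "n \<ge> 1" and q: "q \<ge> 1"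
  defines "S \<equiv> replicate_pmf q (pmf_of_set (grid n d))"
begin

lemma grid_nonempty: "grid n d \<noteq> {}"
  using n card_grid[of n d] by (metis card.empty not_one_le_zero power_eq_0_iff)

lemma set_pmf_sample: "set_pmf S = {qs. set qs \<subseteq> grid n d \<and> length qs = q}"
  by (auto simp: S_def set_replicate_pmf grid_nonempty in_lists_conv_set)

lemma disagreements_binomial:
  "map_pmf (disagreements f g) S = binomial_pmf q (hdist n d f g)"
  unfolding disagreements_def S_def count_replicate_pmf
  by (simp add: grid_nonempty measure_pmf_of_set hdist_def Int_def)

interpretation binomial_distribution q "hdist n d f g" for f g
proof
  have "card {x \<in> grid n d. f x \<noteq> g x} \<le> card (grid n d)"
    by (rule card_mono) auto
  then show "hdist n d f g \<in> {0..1}"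
    by (auto simp: hdist_def divide_le_eq_1)
qed

lemma prob_disagreements_few:
  assumes "\<delta> \<ge> 0"
  shows "measure_pmf.prob S {qs. disagreements f g qs \<le> (hdist n d f g - \<delta>) * q}
           \<le> exp (- 2 * real q * \<delta>\<^sup>2)"
proof -
  have "measure_pmf.prob S {qs. disagreements f g qs \<le> (hdist n d f g - \<delta>) * q} =
        measure_pmf.prob (map_pmf (disagreements f g) S) {m. m / q \<le> hdist n d f g - \<delta>}"
    using q by (simp add: vimage_def field_simps)
  then show ?thesis
    using prob_le'[of \<delta> f g] assms q by (simp add: disagreements_binomial)
qed

lemma prob_disagreements_many:
  assumes "\<delta> \<ge> 0"
  shows "measure_pmf.prob S {qs. disagreements f g qs \<ge> (hdist n d f g + \<delta>) * q}
           \<le> exp (- 2 * real q * \<delta>\<^sup>2)"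
proof -
  have "measure_pmf.prob S {qs. disagreements f g qs \<ge> (hdist n d f g + \<delta>) * q} =
        measure_pmf.prob (map_pmf (disagreements f g) S) {m. m / q \<ge> hdist n d f g + \<delta>}"
    using q by (simp add: vimage_def field_simps)
  then show ?thesis
    using prob_ge'[of \<delta> f g] assms q by (simp add: disagreements_binomial)
qed

text \<open>The threshold 3/4 \<epsilon> lies midway between \<epsilon>/2, reached by some
  \<open>g\<close> in \<open>G\<close> if \<open>f\<close> is \<open>k\<close>-monotone, and
  \<epsilon>, a lower bound for all of \<open>G\<close> if \<open>f\<close> is far. The first case
  needs one good estimate, the second a union bound over \<open>G\<close>.\<close>

lemma tester_from_cover:
  assumes \<epsilon>: "0 < \<epsilon>" and G: "finite G" "G \<noteq> {}"
    and mono: "\<And>g. g \<in> G \<Longrightarrow> k_monotone n d k g"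
    and cover: "\<And>f. k_monotone n d k f \<Longrightarrow> \<exists>g\<in>G. hdist n d f g \<le> \<epsilon> / 2"
    and q_ge: "real q \<ge> 8 * ln (3 * real (card G)) / \<epsilon>\<^sup>2"
  shows "\<exists>T. is_kmon_tester n d k \<epsilon> T \<and> (\<forall>(qs, dec) \<in> set_pmf T. length qs = q)"
proof -
  define dec where "dec qs ans \<longleftrightarrow>
    (\<exists>g\<in>G. real (length (filter (\<lambda>p. fst p \<noteq> g (snd p)) (zip ans qs))) \<le> 3 / 4 * \<epsilon> * q)" for qs ans
  define T where "T = map_pmf (\<lambda>qs. (qs, dec qs)) S"
  have dec: "dec qs (map f qs) \<longleftrightarrow> (\<exists>g\<in>G. real (disagreements f g qs) \<le> 3 / 4 * \<epsilon> * q)" for f qs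
    by (simp only: dec_def disagreements_zip)
  have accept: "accept_prob T f =
      measure_pmf.prob S {qs. \<exists>g\<in>G. real (disagreements f g qs) \<le> 3 / 4 * \<epsilon> * q}" for f
    by (simp add: accept_prob_def T_def vimage_def dec)
  have c: "card G \<ge> 1" using G by (simp add: Suc_le_eq card_gt_0_iff)
  \<comment> \<open>The sample size is chosen so that an estimate is off by \<epsilon>/4 in a given
    direction with probability at most \<open>1 / (3 * card G)\<close>.\<close>
  have "ln (3 * real (card G)) \<le> 2 * real q * (\<epsilon> / 4)\<^sup>2"
    using q_ge \<epsilon> by (simp add: field_simps power2_eq_square)
  then have "exp (- 2 * real q * (\<epsilon> / 4)\<^sup>2) \<le> exp (- ln (3 * real (card G)))"
    by simp
  also have "\<dots> = 1 / (3 * real (card G))"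
    using c by (simp add: exp_minus inverse_eq_divide)
  finally have tail: "exp (- 2 * real q * (\<epsilon> / 4)\<^sup>2) \<le> 1 / (3 * real (card G))" .
  have "accept_prob T f \<ge> 2 / 3" if f: "k_monotone n d k f" for f
  proof -
    obtain g where g: "g \<in> G" "hdist n d f g \<le> \<epsilon> / 2" using cover[OF f] by blast
    let ?A = "{qs. disagreements f g qs \<ge> (hdist n d f g + \<epsilon> / 4) * q}"
    have "measure_pmf.prob S ?A \<le> 1 / (3 * real (card G))"
      using prob_disagreements_many[of "\<epsilon> / 4" f g] \<epsilon> tail by simp
    also have "\<dots> \<le> 1 / 3"
      using c by (simp add: field_simps)
    finally have "2 / 3 \<le> 1 - measure_pmf.prob S ?A" by simp
    also have "\<dots> = measure_pmf.prob S (- ?A)"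
      using measure_pmf.prob_compl[of ?A S] by (simp add: Compl_eq_Diff_UNIV)
    also have "\<dots> \<le> accept_prob T f"
      unfolding accept
    proof (rule measure_pmf.finite_measure_mono)
      show "- ?A \<subseteq> {qs. \<exists>g\<in>G. real (disagreements f g qs) \<le> 3 / 4 * \<epsilon> * q}"
      proof
        fix qs assume "qs \<in> - ?A"
        then have "real (disagreements f g qs) \<le> (hdist n d f g + \<epsilon> / 4) * q" by simp
        also have "\<dots> \<le> 3 / 4 * \<epsilon> * q"
          using g(2) by (intro mult_right_mono) auto
        finally show "qs \<in> {qs. \<exists>g\<in>G. real (disagreements f g qs) \<le> 3 / 4 * \<epsilon> * q}"
          using g(1) by blast
      qed
    qed simp
    finally show ?thesis .
  qed
  moreover have "1 - accept_prob T f \<ge> 2 / 3" if f: "eps_far_k_monotone n d k \<epsilon> f" for f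
  proof -
    let ?A = "\<lambda>g. {qs. real (disagreements f g qs) \<le> 3 / 4 * \<epsilon> * q}"
    have "accept_prob T f = measure_pmf.prob S (\<Union>g\<in>G. ?A g)"
      unfolding accept by (rule arg_cong[of _ _ "measure_pmf.prob S"]) auto
    also have "\<dots> \<le> (\<Sum>g\<in>G. measure_pmf.prob S (?A g))"
      by (rule measure_pmf.finite_measure_subadditive_finite) (use G in auto)
    also have "\<dots> \<le> (\<Sum>g\<in>G. 1 / (3 * real (card G)))"
    proof (rule sum_mono)
      fix g assume g: "g \<in> G"
      have "measure_pmf.prob S (?A g) \<le>
            measure_pmf.prob S {qs. disagreements f g qs \<le> (hdist n d f g - \<epsilon> / 4) * q}"
      proof (rule measure_pmf.finite_measure_mono)
        have "\<epsilon> \<le> hdist n d f g"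
          using f mono[OF g] by (auto simp: eps_far_k_monotone_def)
        then have "3 / 4 * \<epsilon> * q \<le> (hdist n d f g - \<epsilon> / 4) * q"
          by (intro mult_right_mono) auto
        then show "?A g \<subseteq> {qs. disagreements f g qs \<le> (hdist n d f g - \<epsilon> / 4) * q}"
          by auto
      qed simp
      also have "\<dots> \<le> 1 / (3 * real (card G))"
        using prob_disagreements_few[of "\<epsilon> / 4" f g] \<epsilon> tail by simp
      finally show "measure_pmf.prob S (?A g) \<le> 1 / (3 * real (card G))" .
    qed
    also have "\<dots> = 1 / 3" using c by simp
    finally show ?thesis by simp
  qed
  moreover have "\<forall>(qs, dec) \<in> set_pmf T. set qs \<subseteq> grid n d \<and> length qs = q"
    by (auto simp: T_def set_pmf_sample)
  ultimately show ?thesis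
    unfolding is_kmon_tester_def by (intro exI[of _ T]) auto
qed

end

lemma tester_from_signature:
  assumes n: "n \<ge> 1" and \<epsilon>: "0 < \<epsilon>" and V: "finite V"
    and sig: "\<And>f. k_monotone n d k f \<Longrightarrow> \<sigma> f \<in> V"
    and close: "\<And>f g. k_monotone n d k f \<Longrightarrow> k_monotone n d k g \<Longrightarrow> \<sigma> f = \<sigma> g \<Longrightarrow> hdist n d f g \<le> \<epsilon> / 2"
    and q: "8 * ln (3 * real (card V)) / \<epsilon>\<^sup>2 + 1 \<le> q"
  shows "\<exists>T. is_kmon_tester n d k \<epsilon> T \<and> max_queries T q"
proof -
  let ?K = "Collect (k_monotone n d k)"
  \<comment> \<open>One \<open>k\<close>-monotone representative for each signature that
    occurs.\<close>
  define G where "G = inv_into ?K \<sigma> ` \<sigma> ` ?K"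
  have fin: "finite (\<sigma> ` ?K)"
    using sig by (intro finite_subset[OF _ V]) auto
  \<comment> \<open>The constant 0 is \<open>k\<close>-monotone, which keeps \<open>G\<close>
    nonempty.\<close>
  have "k_monotone n d k (\<lambda>_. False)"
    by (simp add: k_monotone_def)
  then have G: "finite G" "G \<noteq> {}"
    using fin by (auto simp: G_def)
  have mono: "k_monotone n d k g" if "g \<in> G" for g
    using that inv_into_into[of _ \<sigma> ?K] by (auto simp: G_def)
  have cover: "\<exists>g\<in>G. hdist n d f g \<le> \<epsilon> / 2" if "k_monotone n d k f" for f
  proof
    show g: "inv_into ?K \<sigma> (\<sigma> f) \<in> G" using that by (simp add: G_def)
    show "hdist n d f (inv_into ?K \<sigma> (\<sigma> f)) \<le> \<epsilon> / 2"
      using that mono[OF g] by (intro close) (simp_all add: f_inv_into_f)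
  qed
  have c: "card G \<ge> 1" using G by (simp add: Suc_le_eq card_gt_0_iff)
  have "card G \<le> card V"
    unfolding G_def using sig by (intro order_trans[OF card_image_le[OF fin]] card_mono[OF V]) auto
  with c have "8 * ln (3 * real (card G)) / \<epsilon>\<^sup>2 \<le> 8 * ln (3 * real (card V)) / \<epsilon>\<^sup>2"
    using \<epsilon> by (intro divide_right_mono mult_left_mono ln_mono) auto
  \<comment> \<open>The summand 1 in the bound on \<open>q\<close> pays for rounding up; the
    logarithm is positive, so at least one sample is drawn.\<close>
  moreover define r where "r = nat \<lceil>8 * ln (3 * real (card G)) / \<epsilon>\<^sup>2\<rceil>"
  moreover have "8 * ln (3 * real (card G)) / \<epsilon>\<^sup>2 > 0"
    using \<epsilon> c by (intro divide_pos_pos mult_pos_pos) (auto intro!: ln_gt_zero)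
  ultimately have r: "r \<ge> 1" "real r \<ge> 8 * ln (3 * real (card G)) / \<epsilon>\<^sup>2" "real r \<le> q"
    using q by linarith+
  obtain T where "is_kmon_tester n d k \<epsilon> T" "\<forall>(qs, dec) \<in> set_pmf T. length qs = r"
    using tester_from_cover[OF n r(1) \<epsilon> G mono cover r(2)] by blast
  with r(3) show ?thesis
    unfolding max_queries_def by (intro exI[of _ T]) auto
qed

section \<open>The signature of values at block corners\<close>

text \<open>\<open>(n - 1) div B + 1\<close> is the number of blocks of length \<open>B\<close> needed to cover \<open>n\<close> points.\<close>

lemma block_lt: "n \<ge> 1 \<Longrightarrow> a < n \<Longrightarrow> a div B < (n - 1) div B + (1::nat)"
  using div_le_mono[of a "n - 1" B] by linarith

lemma corner_lt: "n \<ge> 1 \<Longrightarrow> a < (n - 1) div B + 1 \<Longrightarrow> B * a < (n::nat)"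
  using mult_le_mono2[of a "(n - 1) div B" B] times_div_less_eq_dividend[of B "n - 1"] by linarith

definition corners :: "nat \<Rightarrow> nat \<Rightarrow> nat \<Rightarrow> nat list set" where
  "corners n d B = map ((*) B) ` grid ((n - 1) div B + 1) d"

lemma finite_corners [simp]: "finite (corners n d B)"
  by (simp add: corners_def)

lemma card_corners_le: "card (corners n d B) \<le> ((n - 1) div B + 1) ^ d"
  unfolding corners_def by (rule order_trans[OF card_image_le]) (simp_all add: card_grid)

lemma round_down_in_corners:
  assumes "n \<ge> 1" "x \<in> grid n d"
  shows "round_down B x \<in> corners n d B"
proof -
  have "map (\<lambda>a. a div B) x \<in> grid ((n - 1) div B + 1) d"
    using assms block_lt by (intro map_in_grid) auto
  moreover have "round_down B x = map ((*) B) (map (\<lambda>a. a div B) x)"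
    by (simp add: round_down_def)
  ultimately show ?thesis unfolding corners_def by blast
qed

text \<open>Lets both kinds of signature control the rounded functions only, at the price of
  rounding each function once.\<close>

lemma hdist_via_round_down:
  assumes f: "k_monotone n d k f" and g: "k_monotone n d k g" and B: "B \<ge> 1" and n: "n \<ge> 1"
  shows "hdist n d f g \<le> hdist n d (f \<circ> round_down B) (g \<circ> round_down B)
           + 2 * (real k * real d * real (B - 1) / real n)"
  using hdist_round_down[OF f B n] hdist_round_down[OF g B n]
    hdist_triangle[of n d f g "f \<circ> round_down B"]
    hdist_triangle[of n d "f \<circ> round_down B" g "g \<circ> round_down B"]
    hdist_commute[of n d "g \<circ> round_down B" g]
  unfolding mult_2 by linarith

text \<open>The length \<open>B\<close> is chosen with \<open>B - 1 \<le> n / y \<le> B\<close>: the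
  first inequality limits the rounding error, the second the number of blocks.\<close>

lemma block_size:
  fixes y :: real
  assumes y: "0 < y" and n: "n \<ge> 1"
  defines "B \<equiv> nat \<lfloor>real n / y\<rfloor> + 1"
  shows "real (B - 1) \<le> real n / y" "real ((n - 1) div B + 1) \<le> y + 1"
proof -
  show "real (B - 1) \<le> real n / y"
    using y by (simp add: B_def)
  have "0 < real B" by (simp add: B_def)
  have "real n / y \<le> real B"
    unfolding B_def by linarith
  then have "real n / real B \<le> y"
    using y \<open>0 < real B\<close> by (simp add: field_simps)
  moreover have "real ((n - 1) div B) \<le> real n / real B"
    using of_nat_div_le_of_nat[of "n - 1" B, where 'a = real] divide_right_mono[of "real (n - 1)" "real n" "real B"] by simp
  ultimately show "real ((n - 1) div B + 1) \<le> y + 1" by simp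
qed

lemma tester_brute_force:
  assumes n: "n \<ge> 1" and d: "d \<ge> 1" and k: "k \<ge> 1" and \<epsilon>: "0 < \<epsilon>" "\<epsilon> \<le> 1"
  shows "\<exists>T. is_kmon_tester n d k \<epsilon> T \<and>
             max_queries T (25 * ((1 / \<epsilon>\<^sup>2) * (5 * real k * real d / \<epsilon>) ^ d))"
proof -
  \<comment> \<open>The rounding error is then at most \<open>2 * k * d / y\<close>, which is
    \<epsilon>/2, and the number of blocks per axis is at most \<open>y + 1\<close>, hence at most
    \<open>5 * k * d / \<epsilon>\<close>.\<close>
  define y where "y = 4 * real k * real d / \<epsilon>"
  define B where "B = nat \<lfloor>real n / y\<rfloor> + 1"
  define M where "M = (n - 1) div B + 1"
  have kd: "1 \<le> real k * real d"
    using k d by (metis of_nat_1 of_nat_le_iff of_nat_mult mult_le_mono nat_mult_1)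
  have y: "0 < y" using k d \<epsilon> by (simp add: y_def)
  have B: "B \<ge> 1" by (simp add: B_def)
  have "1 \<le> real k * real d / \<epsilon>" using kd \<epsilon> by (simp add: field_simps)
  then have M: "real M \<le> 5 * real k * real d / \<epsilon>"
  proof -
    have "y = 4 * (real k * real d / \<epsilon>)" "5 * real k * real d / \<epsilon> = 5 * (real k * real d / \<epsilon>)"
      by (simp_all add: y_def)
    with \<open>1 \<le> real k * real d / \<epsilon>\<close> show ?thesis
      using block_size(2)[OF y n] unfolding M_def[symmetric] B_def[symmetric] by linarith
  qed
  have "M ^ d \<ge> 1" by (simp add: M_def)
  then have Md: "1 \<le> real M ^ d" by (metis of_nat_1 of_nat_le_iff of_nat_power)
  have small: "2 * (real k * real d * real (B - 1) / real n) \<le> \<epsilon> / 2"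
  proof -
    have "2 * (real k * real d * real (B - 1) / real n) \<le> 2 * (real k * real d * (real n / y) / real n)"
      using block_size(1)[OF y n] unfolding B_def[symmetric]
      by (intro mult_left_mono divide_right_mono) auto
    also have "\<dots> = \<epsilon> / 2"
      using n k d \<epsilon> by (simp add: y_def field_simps)
    finally show ?thesis .
  qed
  show ?thesis
  proof (rule tester_from_signature[OF n \<epsilon>(1)])
    show "finite (Pow (corners n d B))" by simp
    \<comment> \<open>The signature is the set of corners of value 1. At most
      \<open>2 ^ (M ^ d)\<close> signatures exist, so the sample size is of order
      \<open>M ^ d / \<epsilon>\<^sup>2\<close>, without a logarithmic factor.\<close>
    show "{c \<in> corners n d B. f c} \<in> Pow (corners n d B)" for f by auto
    show "hdist n d f g \<le> \<epsilon> / 2"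
      if fg: "k_monotone n d k f" "k_monotone n d k g"
        and eq: "{c \<in> corners n d B. f c} = {c \<in> corners n d B. g c}" for f g
    proof -
      \<comment> \<open>Every rounded point is a corner, so only the rounding error remains.\<close>
      have "f (round_down B x) = g (round_down B x)" if "x \<in> grid n d" for x
        using eq round_down_in_corners[OF n that, of B] by blast
      then have "hdist n d (f \<circ> round_down B) (g \<circ> round_down B) = 0"
        by (simp add: hdist_def cong: conj_cong)
      with hdist_via_round_down[OF fg B n] small show ?thesis by linarith
    qed
    have "ln (3 * real (card (Pow (corners n d B)))) = ln 3 + real (card (corners n d B)) * ln 2"
      by (simp add: card_Pow ln_mult ln_realpow)
    also have "\<dots> \<le> 2 + real M ^ d * 1"
      using card_corners_le[of n d B, folded M_def] ln_le_minus_one[of "3::real"] ln_2_less_1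
      by (intro add_mono mult_mono) (auto simp flip: of_nat_power)
    also have "\<dots> \<le> 3 * real M ^ d" using Md by simp
    finally have "8 * ln (3 * real (card (Pow (corners n d B)))) / \<epsilon>\<^sup>2 + 1 \<le> 8 * (3 * real M ^ d) / \<epsilon>\<^sup>2 + real M ^ d / \<epsilon>\<^sup>2"
    proof (intro add_mono divide_right_mono mult_left_mono)
      have "\<epsilon>\<^sup>2 \<le> 1" using \<epsilon> by (simp add: power_le_one)
      then show "1 \<le> real M ^ d / \<epsilon>\<^sup>2" using Md \<epsilon> by (simp add: field_simps)
    qed auto
    also have "\<dots> = 25 * ((1 / \<epsilon>\<^sup>2) * real M ^ d)" by (simp add: field_simps)
    also have "\<dots> \<le> 25 * ((1 / \<epsilon>\<^sup>2) * (5 * real k * real d / \<epsilon>) ^ d)"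
      using M by (intro mult_left_mono power_mono) auto
    finally show "8 * ln (3 * real (card (Pow (corners n d B)))) / \<epsilon>\<^sup>2 + 1
        \<le> 25 * ((1 / \<epsilon>\<^sup>2) * (5 * real k * real d / \<epsilon>) ^ d)" .
  qed
qed

section \<open>Fourier analysis on the discrete cube\<close>

text \<open>Points of the cube \<open>Pow U\<close> are given by their supports, and
  \<open>walsh S\<close> is the character with index \<open>S\<close>. Points and indices are both
  subsets of \<open>U\<close>, and the formula is symmetric in them.\<close>

definition walsh :: "'a set \<Rightarrow> 'a set \<Rightarrow> real" where
  "walsh S A = (-1) ^ card (A \<inter> S)"

definition fourier :: "'a set \<Rightarrow> ('a set \<Rightarrow> real) \<Rightarrow> 'a set \<Rightarrow> real" where
  "fourier U F S = (\<Sum>A\<in>Pow U. F A * walsh S A) / 2 ^ card U"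

definition flip :: "'a \<Rightarrow> 'a set \<Rightarrow> 'a set" where
  "flip u A = (if u \<in> A then A - {u} else insert u A)"

lemma flip_flip [simp]: "flip u (flip u A) = A"
  by (auto simp: flip_def)

lemma flip_subset: "u \<in> U \<Longrightarrow> A \<subseteq> U \<Longrightarrow> flip u A \<subseteq> U"
  by (auto simp: flip_def)

lemma sum_flip:
  assumes "u \<in> U"
  shows "(\<Sum>A\<in>Pow U. g (flip u A)) = (\<Sum>A\<in>Pow U. g A)"
  by (rule sum.reindex_bij_witness[of _ "flip u" "flip u"]) (use assms in \<open>simp_all add: flip_subset\<close>)

lemma walsh_commute: "walsh S A = walsh A S"
  by (simp add: walsh_def Int_commute)

lemma abs_walsh [simp]: "\<bar>walsh S A\<bar> = 1"
  by (simp add: walsh_def power_abs)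

lemma walsh_square [simp]: "walsh S A * walsh S A = 1"
  by (cases "even (card (A \<inter> S))") (simp_all add: walsh_def)

lemma walsh_flip:
  assumes "finite A"
  shows "walsh S (flip u A) = (if u \<in> S then - walsh S A else walsh S A)"
proof (cases "u \<in> S")
  case True
  show ?thesis
  proof (cases "u \<in> A")
    case True
    have "A \<inter> S = insert u ((A - {u}) \<inter> S)" using True \<open>u \<in> S\<close> by auto
    then have "card (A \<inter> S) = Suc (card ((A - {u}) \<inter> S))"
      using assms by (metis Diff_iff IntD1 card_insert_disjoint finite_Diff finite_Int insertI1)
    then show ?thesis using True \<open>u \<in> S\<close> by (simp add: walsh_def flip_def)
  next
    case False
    have "insert u A \<inter> S = insert u (A \<inter> S)" using \<open>u \<in> S\<close> by auto
    then show ?thesis using False \<open>u \<in> S\<close> assms by (simp add: walsh_def flip_def)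
  qed
next
  case False
  then have "flip u A \<inter> S = A \<inter> S" by (auto simp: flip_def)
  then show ?thesis using False by (simp add: walsh_def)
qed

text \<open>If \<open>u\<close> lies in exactly one of \<open>A\<close> and \<open>B\<close>,
  flipping \<open>u\<close> negates the product, so the sum equals its own negative.\<close>

lemma walsh_orthogonal:
  assumes U: "finite U" and A: "A \<subseteq> U" and B: "B \<subseteq> U"
  shows "(\<Sum>S\<in>Pow U. walsh A S * walsh B S) = (if A = B then 2 ^ card U else 0)"
proof (cases "A = B")
  case True
  then show ?thesis using U by (simp add: card_Pow)
next
  case False
  then obtain u where u: "u \<in> U" "u \<in> A \<longleftrightarrow> u \<notin> B" using A B by blast
  have "(\<Sum>S\<in>Pow U. walsh A S * walsh B S) = (\<Sum>S\<in>Pow U. walsh A (flip u S) * walsh B (flip u S))"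
    by (rule sum_flip[OF u(1), symmetric])
  also have "\<dots> = (\<Sum>S\<in>Pow U. - (walsh A S * walsh B S))"
    using u U by (intro sum.cong) (auto simp: walsh_flip finite_subset)
  finally show ?thesis using False by (simp add: sum_negf)
qed

lemma parseval:
  assumes U: "finite U"
  shows "(\<Sum>S\<in>Pow U. (fourier U F S)\<^sup>2) = (\<Sum>A\<in>Pow U. (F A)\<^sup>2) / 2 ^ card U"
proof -
  let ?N = "2 ^ card U :: real"
  have "(\<Sum>S\<in>Pow U. (fourier U F S)\<^sup>2) * ?N\<^sup>2 =
        (\<Sum>S\<in>Pow U. \<Sum>A\<in>Pow U. \<Sum>B\<in>Pow U. F A * F B * (walsh A S * walsh B S))"
    unfolding sum_distrib_right
    by (intro sum.cong)
       (auto simp: fourier_def power2_eq_square sum_product walsh_commute[of _ "_::'a set"] mult_ac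
             intro!: sum.cong)
  also have "\<dots> = (\<Sum>A\<in>Pow U. \<Sum>B\<in>Pow U. F A * F B * (\<Sum>S\<in>Pow U. walsh A S * walsh B S))"
    unfolding sum_distrib_left by (rule trans[OF sum.swap], rule sum.cong[OF refl], rule sum.swap)
  also have "\<dots> = (\<Sum>A\<in>Pow U. \<Sum>B\<in>Pow U. if A = B then F A * F B * ?N else 0)"
    using walsh_orthogonal[OF U] by (intro sum.cong refl) auto
  also have "\<dots> = (\<Sum>A\<in>Pow U. (F A)\<^sup>2) * ?N"
    using U by (simp add: sum.delta power2_eq_square sum_distrib_right)
  finally show ?thesis by (simp add: power2_eq_square field_simps)
qed

section \<open>Influences and the Fourier tail\<close>

lemma fourier_diff: "fourier U (\<lambda>A. F A - G A) S = fourier U F S - fourier U G S"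
  by (simp add: fourier_def left_diff_distrib sum_subtractf diff_divide_distrib)

lemma fourier_flip:
  assumes "finite U" "u \<in> U"
  shows "fourier U (\<lambda>A. F (flip u A)) S = (if u \<in> S then - fourier U F S else fourier U F S)"
proof -
  have "(\<Sum>A\<in>Pow U. F (flip u A) * walsh S A) = (\<Sum>A\<in>Pow U. F A * walsh S (flip u A))"
    using sum_flip[OF assms(2), of "\<lambda>A. F A * walsh S (flip u A)"] by simp
  also have "\<dots> = (if u \<in> S then -1 else 1) * (\<Sum>A\<in>Pow U. F A * walsh S A)"
    unfolding sum_distrib_left
    by (intro sum.cong refl) (use assms in \<open>auto simp: walsh_flip finite_subset\<close>)
  finally show ?thesis by (simp add: fourier_def)
qed

text \<open>The difference in direction \<open>u\<close> doubles the coefficients with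
  \<open>u\<close> in \<open>S\<close> and kills the others. Parseval applies for each
  \<open>u\<close>, and summing over \<open>u\<close> counts every \<open>S\<close> exactly
  \<open>card S\<close> times.\<close>

lemma total_influence_fourier:
  assumes U: "finite U"
  shows "(\<Sum>u\<in>U. (\<Sum>A\<in>Pow U. (F A - F (flip u A))\<^sup>2) / 2 ^ card U) =
         4 * (\<Sum>S\<in>Pow U. real (card S) * (fourier U F S)\<^sup>2)"
proof -
  have "(\<Sum>u\<in>U. (\<Sum>A\<in>Pow U. (F A - F (flip u A))\<^sup>2) / 2 ^ card U) =
        (\<Sum>u\<in>U. \<Sum>S\<in>Pow U. if u \<in> S then 4 * (fourier U F S)\<^sup>2 else 0)"
    by (intro sum.cong refl, subst parseval[OF U, symmetric])
       (auto simp: fourier_diff fourier_flip U power2_eq_square intro!: sum.cong)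
  also have "\<dots> = (\<Sum>S\<in>Pow U. \<Sum>u\<in>U. if u \<in> S then 4 * (fourier U F S)\<^sup>2 else 0)"
    by (rule sum.swap)
  also have "\<dots> = (\<Sum>S\<in>Pow U. real (card S) * (4 * (fourier U F S)\<^sup>2))"
    using U by (intro sum.cong refl) (simp add: sum.If_cases Int_absorb1)
  finally show ?thesis by (simp add: sum_distrib_left mult_ac)
qed

text \<open>Since \<open>H\<close> is monotone, \<open>\<bar>H A - H (flip u A)\<bar>\<close> is \<open>H A - H (flip u A)\<close> up to the sign of the
  coordinate \<open>u\<close>; the total influence of \<open>H\<close> thus is its correlation with the sum of all
  coordinates, and Cauchy--Schwarz applies.\<close>

lemma total_variation_monotone_le:
  fixes H :: "'a set \<Rightarrow> nat"
  assumes U: "finite U" and mono: "\<And>A B. A \<subseteq> B \<Longrightarrow> B \<subseteq> U \<Longrightarrow> H A \<le> H B"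
    and bound: "\<And>A. A \<subseteq> U \<Longrightarrow> H A \<le> k"
  shows "(\<Sum>u\<in>U. \<Sum>A\<in>Pow U. \<bar>real (H A) - real (H (flip u A))\<bar>)
           \<le> 2 * real k * sqrt (card U) * 2 ^ card U"
proof -
  define Y :: "'a set \<Rightarrow> real" where "Y A = (\<Sum>u\<in>U. walsh {u} A)" for A
  have sgn: "\<bar>real (H A) - real (H (flip u A))\<bar> = - walsh {u} A * (real (H A) - real (H (flip u A)))"
    if "u \<in> U" "A \<subseteq> U" for u A
    using mono[of "A - {u}" A] mono[OF subset_insertI, of u A] that
    by (auto simp: walsh_def flip_def)
  have inner: "(\<Sum>A\<in>Pow U. \<bar>real (H A) - real (H (flip u A))\<bar>) = -2 * (\<Sum>A\<in>Pow U. walsh {u} A * real (H A))"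
    if u: "u \<in> U" for u
  proof -
    have "(\<Sum>A\<in>Pow U. \<bar>real (H A) - real (H (flip u A))\<bar>) =
          (\<Sum>A\<in>Pow U. - walsh {u} A * real (H A)) + (\<Sum>A\<in>Pow U. walsh {u} A * real (H (flip u A)))"
      unfolding sum.distrib[symmetric] by (intro sum.cong refl) (use sgn u in \<open>auto simp: algebra_simps\<close>)
    also have "(\<Sum>A\<in>Pow U. walsh {u} A * real (H (flip u A))) =
               (\<Sum>A\<in>Pow U. walsh {u} (flip u A) * real (H A))"
      using sum_flip[OF u, of "\<lambda>A. walsh {u} (flip u A) * real (H A)"] by simp
    also have "\<dots> = (\<Sum>A\<in>Pow U. - walsh {u} A * real (H A))"
      by (intro sum.cong refl) (use U in \<open>auto simp: walsh_flip finite_subset\<close>)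
    finally show ?thesis by (simp add: sum_negf)
  qed
  have "(\<Sum>u\<in>U. \<Sum>A\<in>Pow U. \<bar>real (H A) - real (H (flip u A))\<bar>) =
        (\<Sum>u\<in>U. -2 * (\<Sum>A\<in>Pow U. walsh {u} A * real (H A)))"
    by (intro sum.cong refl inner)
  also have "\<dots> = -2 * (\<Sum>A\<in>Pow U. real (H A) * Y A)"
    unfolding sum_distrib_left[symmetric] Y_def
    by (subst sum.swap) (simp add: sum_distrib_left mult.commute)
  also have "\<dots> \<le> 2 * \<bar>\<Sum>A\<in>Pow U. real (H A) * Y A\<bar>" by linarith
  also have "\<bar>\<Sum>A\<in>Pow U. real (H A) * Y A\<bar> \<le> real k * sqrt (card U) * 2 ^ card U"
  proof -
    have "(\<Sum>A\<in>Pow U. real (H A) * Y A)\<^sup>2 \<le> (\<Sum>A\<in>Pow U. (real (H A))\<^sup>2) * (\<Sum>A\<in>Pow U. (Y A)\<^sup>2)"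
      by (rule Cauchy_Schwarz_ineq_sum)
    also have "(\<Sum>A\<in>Pow U. (Y A)\<^sup>2) = (\<Sum>A\<in>Pow U. \<Sum>u\<in>U. \<Sum>v\<in>U. walsh {u} A * walsh {v} A)"
      by (simp add: Y_def power2_eq_square sum_product)
    also have "\<dots> = (\<Sum>u\<in>U. \<Sum>v\<in>U. \<Sum>A\<in>Pow U. walsh {u} A * walsh {v} A)"
      by (rule trans[OF sum.swap], rule sum.cong[OF refl], rule sum.swap)
    \<comment> \<open>Distinct coordinates are orthogonal, so only the diagonal survives; this is
      the source of the square root in the bound.\<close>
    also have "\<dots> = (\<Sum>u\<in>U. \<Sum>v\<in>U. if u = v then 2 ^ card U else 0)"
      by (intro sum.cong refl, subst walsh_orthogonal[OF U]) auto
    also have "\<dots> = real (card U) * 2 ^ card U"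
      using U by simp
    also have "(\<Sum>A\<in>Pow U. (real (H A))\<^sup>2) \<le> (\<Sum>A\<in>Pow U. (real k)\<^sup>2)"
      using bound by (intro sum_mono power_mono) auto
    also have "\<dots> = 2 ^ card U * (real k)\<^sup>2"
      using U by (simp add: card_Pow)
    finally have "(\<Sum>A\<in>Pow U. real (H A) * Y A)\<^sup>2 \<le> 2 ^ card U * (real k)\<^sup>2 * (real (card U) * 2 ^ card U)"
      by (simp add: mult_right_mono)
    also have "\<dots> = (real k * sqrt (card U) * 2 ^ card U)\<^sup>2"
      by (simp add: power_mult_distrib power2_eq_square)
    finally show ?thesis
      by (intro power2_le_imp_le[of "\<bar>_\<bar>"]) auto
  qed
  finally show ?thesis by (simp add: mult.assoc)
qed

text \<open>Markov's inequality for the weights \<open>card S\<close>. The parity changes across an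
  edge only if \<open>H\<close> does, and then its squared difference is at most that of
  \<open>H\<close> in absolute value. The \<open>1 / 2\<close> is 2 divided by the 4 of
  \<open>total_influence_fourier\<close>.\<close>

lemma fourier_tail_parity:
  fixes H :: "'a set \<Rightarrow> nat"
  assumes U: "finite U" and mono: "\<And>A B. A \<subseteq> B \<Longrightarrow> B \<subseteq> U \<Longrightarrow> H A \<le> H B"
    and bound: "\<And>A. A \<subseteq> U \<Longrightarrow> H A \<le> k"
    and F: "\<And>A. A \<subseteq> U \<Longrightarrow> F A = of_bool (odd (H A))"
  shows "real t * (\<Sum>S | S \<subseteq> U \<and> t < card S. (fourier U F S)\<^sup>2) \<le> real k * sqrt (card U) / 2"
proof -
  have "real t * (\<Sum>S | S \<subseteq> U \<and> t < card S. (fourier U F S)\<^sup>2) \<le>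
        (\<Sum>S | S \<subseteq> U \<and> t < card S. real (card S) * (fourier U F S)\<^sup>2)"
    unfolding sum_distrib_left by (intro sum_mono mult_right_mono) auto
  also have "\<dots> \<le> (\<Sum>S\<in>Pow U. real (card S) * (fourier U F S)\<^sup>2)"
    using U by (intro sum_mono2) auto
  also have "4 * \<dots> = (\<Sum>u\<in>U. \<Sum>A\<in>Pow U. (F A - F (flip u A))\<^sup>2) / 2 ^ card U"
    using total_influence_fourier[OF U] by (simp add: sum_divide_distrib)
  also have "\<dots> \<le> (\<Sum>u\<in>U. \<Sum>A\<in>Pow U. \<bar>real (H A) - real (H (flip u A))\<bar>) / 2 ^ card U"
  proof (intro divide_right_mono sum_mono)
    fix u A assume "u \<in> U" "A \<in> Pow U"
    then have "A \<subseteq> U" "flip u A \<subseteq> U" by (simp_all add: flip_subset)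
    then show "(F A - F (flip u A))\<^sup>2 \<le> \<bar>real (H A) - real (H (flip u A))\<bar>"
      by (cases "H A = H (flip u A)") (auto simp: F of_bool_def)
  qed simp
  also have "\<dots> \<le> 2 * real k * sqrt (card U)"
    using total_variation_monotone_le[OF U mono bound] by (simp add: field_simps)
  finally show ?thesis by simp
qed

lemma card_subsets_card_le:
  assumes "finite U"
  shows "card {S. S \<subseteq> U \<and> card S \<le> t} \<le> (card U + 1) ^ t"
proof -
  let ?X = "{xs. set xs \<subseteq> insert None (Some ` U) \<and> length xs = t}"
  let ?g = "\<lambda>xs. {u. Some u \<in> set xs}"
  have "{S. S \<subseteq> U \<and> card S \<le> t} \<subseteq> ?g ` ?X"
  proof clarify
    fix S assume S: "S \<subseteq> U" "card S \<le> t"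
    obtain xs where xs: "set xs = S" "length xs = card S"
      using finite_distinct_list[of S] finite_subset[OF S(1) assms] distinct_card by metis
    let ?ys = "map Some xs @ replicate (t - card S) None"
    have "?ys \<in> ?X" "?g ?ys = S" using xs S by auto
    then show "S \<in> ?g ` ?X" by blast
  qed
  then have "card {S. S \<subseteq> U \<and> card S \<le> t} \<le> card ?X"
    using assms by (intro surj_card_le) (auto intro: finite_lists_length_eq)
  also have "\<dots> = (card U + 1) ^ t"
    using assms by (subst card_lists_length_eq) (auto simp: card_insert_if card_image)
  finally show ?thesis .
qed

lemma abs_fourier_le:
  assumes "finite U" "\<And>A. A \<subseteq> U \<Longrightarrow> \<bar>F A\<bar> \<le> 1"
  shows "\<bar>fourier U F S\<bar> \<le> 1"
proof -
  have "\<bar>\<Sum>A\<in>Pow U. F A * walsh S A\<bar> \<le> (\<Sum>A\<in>Pow U. \<bar>F A * walsh S A\<bar>)"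
    by (rule sum_abs)
  also have "\<dots> \<le> (\<Sum>A\<in>Pow U. 1)"
    using assms by (intro sum_mono) (auto simp: abs_mult)
  also have "\<dots> = 2 ^ card U" using assms by (simp add: card_Pow)
  finally show ?thesis by (simp add: fourier_def)
qed

text \<open>By Parseval the disagreement is the sum of the squared differences of coefficients: up
  to degree \<open>t\<close> each costs at most \<open>\<delta>\<^sup>2\<close>, and beyond it both
  functions have small tails.\<close>

lemma parity_disagreement_le:
  fixes H H' :: "'a set \<Rightarrow> nat"
  assumes U: "finite U"
    and H: "\<And>A B. A \<subseteq> B \<Longrightarrow> B \<subseteq> U \<Longrightarrow> H A \<le> H B" "\<And>A. A \<subseteq> U \<Longrightarrow> H A \<le> k"
    and H': "\<And>A B. A \<subseteq> B \<Longrightarrow> B \<subseteq> U \<Longrightarrow> H' A \<le> H' B" "\<And>A. A \<subseteq> U \<Longrightarrow> H' A \<le> k"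
    and F: "\<And>A. A \<subseteq> U \<Longrightarrow> F A \<longleftrightarrow> odd (H A)" and F': "\<And>A. A \<subseteq> U \<Longrightarrow> F' A \<longleftrightarrow> odd (H' A)"
    and t: "t \<ge> 1"
    and close: "\<And>S. S \<subseteq> U \<Longrightarrow> card S \<le> t \<Longrightarrow>
      \<bar>fourier U (\<lambda>A. of_bool (F A)) S - fourier U (\<lambda>A. of_bool (F' A)) S\<bar> \<le> \<delta>"
  shows "card {A \<in> Pow U. F A \<noteq> F' A} / 2 ^ card U
           \<le> real (card {S. S \<subseteq> U \<and> card S \<le> t}) * \<delta>\<^sup>2 + 2 * real k * sqrt (card U) / t"
proof -
  let ?f = "fourier U (\<lambda>A. of_bool (F A))" and ?g = "fourier U (\<lambda>A. of_bool (F' A))"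
  let ?lo = "{S. S \<subseteq> U \<and> card S \<le> t}" and ?hi = "{S. S \<subseteq> U \<and> t < card S}"
  have fin: "finite ?lo" "finite ?hi" using U by auto
  have "real (card {A \<in> Pow U. F A \<noteq> F' A}) = (\<Sum>A\<in>Pow U. if F A \<noteq> F' A then 1 else 0)"
    using U by (simp add: sum.If_cases Int_def)
  also have "\<dots> = (\<Sum>A\<in>Pow U. (of_bool (F A) - of_bool (F' A))\<^sup>2)"
    by (intro sum.cong) auto
  finally have "card {A \<in> Pow U. F A \<noteq> F' A} / 2 ^ card U = (\<Sum>S\<in>Pow U. (?f S - ?g S)\<^sup>2)"
    by (simp add: parseval[OF U, symmetric] fourier_diff)
  also have "\<dots> = (\<Sum>S\<in>?lo. (?f S - ?g S)\<^sup>2) + (\<Sum>S\<in>?hi. (?f S - ?g S)\<^sup>2)"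
    using fin by (subst sum.union_disjoint[symmetric]) (auto intro!: sum.cong)
  also have "(\<Sum>S\<in>?lo. (?f S - ?g S)\<^sup>2) \<le> (\<Sum>S\<in>?lo. \<delta>\<^sup>2)"
  proof (rule sum_mono)
    fix S assume "S \<in> ?lo"
    then show "(?f S - ?g S)\<^sup>2 \<le> \<delta>\<^sup>2"
      using close[of S] power_mono[of "\<bar>?f S - ?g S\<bar>" \<delta> 2] by simp
  qed
  also have "(\<Sum>S\<in>?hi. (?f S - ?g S)\<^sup>2) \<le> 2 * (\<Sum>S\<in>?hi. (?f S)\<^sup>2) + 2 * (\<Sum>S\<in>?hi. (?g S)\<^sup>2)"
    unfolding sum_distrib_left sum.distrib[symmetric]
  proof (rule sum_mono)
    fix S
    show "(?f S - ?g S)\<^sup>2 \<le> 2 * (?f S)\<^sup>2 + 2 * (?g S)\<^sup>2"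
      using zero_le_power2[of "?f S + ?g S"] by (simp add: power2_sum power2_diff)
  qed
  also have "(\<Sum>S\<in>?hi. (?f S)\<^sup>2) \<le> real k * sqrt (card U) / 2 / t"
    using fourier_tail_parity[OF U H, where F = "\<lambda>A. of_bool (F A)" and t = t] F t by (simp add: field_simps)
  also have "(\<Sum>S\<in>?hi. (?g S)\<^sup>2) \<le> real k * sqrt (card U) / 2 / t"
    using fourier_tail_parity[OF U H', where F = "\<lambda>A. of_bool (F' A)" and t = t] F' t by (simp add: field_simps)
  finally show ?thesis by (simp add: field_simps)
qed

section \<open>From the grid to the cube\<close>

lemma set_encode_mono: "finite Y \<Longrightarrow> X \<subseteq> Y \<Longrightarrow> set_encode X \<le> set_encode Y"
  unfolding set_encode_def by (rule sum_mono2) auto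

lemma set_encode_less: "X \<subseteq> {..<R} \<Longrightarrow> set_encode X < 2 ^ R"
proof -
  assume "X \<subseteq> {..<R}"
  then have "set_encode X \<le> (\<Sum>i<R. 2 ^ i)"
    using set_encode_mono[of "{..<R}" X] by (simp add: set_encode_def)
  also have "\<dots> < 2 ^ R"
    using sum_power2[of R] by (simp add: atLeast0LessThan)
  finally show ?thesis .
qed

text \<open>The pair \<open>(i, j)\<close> lies in \<open>A\<close> iff bit \<open>j\<close> of
  coordinate \<open>i\<close> is set.\<close>

definition binary_point :: "nat \<Rightarrow> (nat \<times> nat) set \<Rightarrow> nat list" where
  "binary_point d A = map (\<lambda>i. set_encode {j. (i, j) \<in> A}) [0..<d]"

lemma bij_betw_binary_point:
  "bij_betw (binary_point d) (Pow ({..<d} \<times> {..<R})) (grid (2 ^ R) d)"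
proof -
  let ?U = "{..<d} \<times> {..<R}"
  have sub: "{j. (i, j) \<in> A} \<subseteq> {..<R}" if "A \<subseteq> ?U" for i A
    using that by auto
  have inj: "inj_on (binary_point d) (Pow ?U)"
  proof (rule inj_onI)
    fix A B assume A: "A \<in> Pow ?U" and B: "B \<in> Pow ?U" and eq: "binary_point d A = binary_point d B"
    have "{j. (i, j) \<in> A} = {j. (i, j) \<in> B}" if "i < d" for i
    proof -
      have "set_encode {j. (i, j) \<in> A} = set_encode {j. (i, j) \<in> B}"
        using eq that by (simp add: binary_point_def map_eq_conv)
      moreover have "finite {j. (i, j) \<in> A}" "finite {j. (i, j) \<in> B}"
        using A B sub by (meson PowD finite_lessThan finite_subset)+
      ultimately show ?thesis by (simp add: set_encode_eq)
    qed
    then show "A = B" using A B by blast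
  qed
  moreover have "binary_point d ` Pow ?U = grid (2 ^ R) d"
  \<comment> \<open>Surjectivity by counting: both sides have \<open>2 ^ (d * R)\<close>
    elements.\<close>
  proof (rule card_subset_eq)
    show "binary_point d ` Pow ?U \<subseteq> grid (2 ^ R) d"
      using sub by (auto simp: binary_point_def grid_def intro!: set_encode_less)
    show "card (binary_point d ` Pow ?U) = card (grid (2 ^ R) d)"
      by (simp add: card_image[OF inj] card_Pow card_cartesian_product card_grid power_mult[symmetric] mult.commute)
  qed simp
  ultimately show ?thesis by (simp add: bij_betw_def)
qed

lemma binary_point_mono:
  assumes "A \<subseteq> A'" "A' \<subseteq> {..<d} \<times> {..<R}"
  shows "coord_le (binary_point d A) (binary_point d A')"
proof -
  have "set_encode {j. (i, j) \<in> A} \<le> set_encode {j. (i, j) \<in> A'}" for i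
    using assms by (intro set_encode_mono) (auto intro: finite_subset[of _ "{..<R}"])
  then show ?thesis by (simp add: coord_le_def binary_point_def)
qed

text \<open>A point is determined by its block indices and its residues modulo \<open>B\<close>, so
  at most \<open>B ^ d\<close> points round to one corner; the last block may be incomplete.\<close>

lemma card_round_down_le:
  assumes "n \<ge> 1" "B \<ge> 1"
  defines "M \<equiv> (n - 1) div B + 1"
  shows "card {x \<in> grid n d. P (round_down B x)} \<le> card {z \<in> grid M d. P (map ((*) B) z)} * B ^ d"
proof -
  let ?g = "\<lambda>x. (map (\<lambda>a. a div B) x, map (\<lambda>a. a mod B) x)"
  have "inj_on ?g {x \<in> grid n d. P (round_down B x)}"
  proof (rule inj_onI)
    fix x y assume "x \<in> {x \<in> grid n d. P (round_down B x)}" "y \<in> {x \<in> grid n d. P (round_down B x)}"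
      and eq: "?g x = ?g y"
    then have len: "length x = d" "length y = d" by (auto simp: grid_def)
    show "x = y"
    proof (rule nth_equalityI)
      fix i assume i: "i < length x"
      have "map (\<lambda>a. a div B) x ! i = map (\<lambda>a. a div B) y ! i"
        "map (\<lambda>a. a mod B) x ! i = map (\<lambda>a. a mod B) y ! i" using eq by simp_all
      then show "x ! i = y ! i" using i len by (metis div_mult_mod_eq nth_map)
    qed (simp add: len)
  qed
  moreover have "?g ` {x \<in> grid n d. P (round_down B x)} \<subseteq> {z \<in> grid M d. P (map ((*) B) z)} \<times> grid B d"
    using assms block_lt by (auto simp: round_down_def o_def intro!: map_in_grid)
  ultimately have "card {x \<in> grid n d. P (round_down B x)} \<le> card ({z \<in> grid M d. P (map ((*) B) z)} \<times> grid B d)"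
    by (intro card_inj_on_le) auto
  then show ?thesis by (simp add: card_cartesian_product card_grid)
qed

text \<open>Groups of \<open>b\<close> consecutive numbers are sent to the corners of the \<open>M\<close> blocks of length \<open>B\<close>;
  the minimum sends all surplus numbers \<open>\<ge> b * M\<close> to the last corner.\<close>

definition cell :: "nat \<Rightarrow> nat \<Rightarrow> nat \<Rightarrow> nat \<Rightarrow> nat" where
  "cell B M b a = B * min (a div b) (M - 1)"

lemma mono_cell: "mono (cell B M b)"
  unfolding cell_def by (intro monoI mult_le_mono2 min.mono div_le_mono order_refl)

text \<open>Every corner is the image of at least \<open>b ^ d\<close> points, namely those with
  coordinates \<open>b * z ! i + u ! i\<close> for \<open>u ! i < b\<close>; the last cell may have
  more.\<close>

lemma card_cells_ge:
  assumes "b \<ge> 1" "M \<ge> 1" "b * M \<le> m"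
  shows "card {z \<in> grid M d. P (map ((*) B) z)} * b ^ d \<le> card {w \<in> grid m d. P (map (cell B M b) w)}"
proof -
  let ?Z = "{z \<in> grid M d. P (map ((*) B) z)}"
  let ?g = "\<lambda>(z, u). map (\<lambda>i. b * z ! i + u ! i) [0..<d]"
  have "inj_on ?g (?Z \<times> grid b d)"
  proof (rule inj_onI, clarify)
    fix z u z' u'
    assume in_grid: "z \<in> grid M d" "u \<in> grid b d" "z' \<in> grid M d" "u' \<in> grid b d"
      and eq: "map (\<lambda>i. b * z ! i + u ! i) [0..<d] = map (\<lambda>i. b * z' ! i + u' ! i) [0..<d]"
    have "z ! i = z' ! i \<and> u ! i = u' ! i" if i: "i < d" for i
    proof -
      have e: "b * z ! i + u ! i = b * z' ! i + u' ! i"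
        using eq i by (simp add: map_eq_conv)
      have u: "u ! i < b" "u' ! i < b" using in_grid i by (auto simp: grid_def)
      have "z ! i = (b * z ! i + u ! i) div b" "z' ! i = (b * z' ! i + u' ! i) div b"
        using u by simp_all
      with e show ?thesis by simp
    qed
    then show "z = z' \<and> u = u'"
      using in_grid by (auto simp: grid_def intro!: nth_equalityI)
  qed
  moreover have "?g (z, u) \<in> {w \<in> grid m d. P (map (cell B M b) w)}"
    if z: "z \<in> grid M d" "P (map ((*) B) z)" and u: "u \<in> grid b d" for z u
  proof -
    have "b * z ! i + u ! i < m" if "i < d" for i
    proof -
      have "b * z ! i + u ! i < b * (z ! i + 1)"
        using u that by (simp add: grid_def)
      also have "\<dots> \<le> b * M"
        using z that by (intro mult_le_mono2) (auto simp: grid_def Suc_le_eq)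
      finally show ?thesis using assms by linarith
    qed
    then have "map (\<lambda>i. b * z ! i + u ! i) [0..<d] \<in> grid m d"
      by (simp add: grid_def)
    moreover have "map (cell B M b) (map (\<lambda>i. b * z ! i + u ! i) [0..<d]) = map ((*) B) z"
    proof (rule nth_equalityI)
      fix i assume "i < length (map (cell B M b) (map (\<lambda>i. b * z ! i + u ! i) [0..<d]))"
      then have i: "i < d" by simp
      have "min (z ! i) (M - 1) = z ! i" "u ! i < b" using z u i by (auto simp: grid_def)
      then show "map (cell B M b) (map (\<lambda>i. b * z ! i + u ! i) [0..<d]) ! i = map ((*) B) z ! i"
        using i z assms by (simp add: cell_def grid_def)
    qed (use z in \<open>simp add: grid_def\<close>)
    ultimately show ?thesis using z by simp
  qed
  then have "?g ` (?Z \<times> grid b d) \<subseteq> {w \<in> grid m d. P (map (cell B M b) w)}"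
    by blast
  ultimately have "card (?Z \<times> grid b d) \<le> card {w \<in> grid m d. P (map (cell B M b) w)}"
    by (intro card_inj_on_le) auto
  then show ?thesis by (simp add: card_cartesian_product card_grid)
qed

text \<open>A corner has weight at most \<open>(B / n) ^ d\<close> in the grid and at least
  \<open>(b / 2 ^ R) ^ d\<close> in the cube. By \<open>ratio\<close> the quotient is at most
  \<open>(1 + 1 / d) ^ d\<close>, hence at most \<open>exp 1\<close> and so at most 3.\<close>

lemma hdist_round_down_le_cube:
  assumes n: "n \<ge> 1" and B: "B \<ge> 1" and b: "b \<ge> 1"
    and bM: "b * ((n - 1) div B + 1) \<le> 2 ^ R"
    and ratio: "real B * 2 ^ R \<le> (1 + 1 / real d) * (real n * real b)" and d: "d \<ge> 1"
  shows "hdist n d (f \<circ> round_down B) (g \<circ> round_down B) \<le>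
    3 * (card {A \<in> Pow ({..<d} \<times> {..<R}).
           f (map (cell B ((n - 1) div B + 1) b) (binary_point d A)) \<noteq>
           g (map (cell B ((n - 1) div B + 1) b) (binary_point d A))} / 2 ^ (d * R))"
proof -
  let ?M = "(n - 1) div B + 1" and ?P = "\<lambda>x. f x \<noteq> g x"
  let ?A = "{A \<in> Pow ({..<d} \<times> {..<R}). ?P (map (cell B ?M b) (binary_point d A))}"
  let ?X = "{x \<in> grid n d. ?P (round_down B x)}"
  let ?Z = "{z \<in> grid ?M d. ?P (map ((*) B) z)}"
  have "bij_betw (binary_point d) ?A {w \<in> grid (2 ^ R) d. ?P (map (cell B ?M b) w)}"
    using bij_betw_binary_point[of d R] by (auto simp: bij_betw_def inj_on_def)
  then have cube: "card {w \<in> grid (2 ^ R) d. ?P (map (cell B ?M b) w)} = card ?A"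
    by (rule bij_betw_same_card[symmetric])
  have 1: "real (card ?X) \<le> real (card ?Z) * real B ^ d"
    using card_round_down_le[OF n B, where P = ?P and d = d] by (simp flip: of_nat_mult of_nat_power)
  have "card ?Z * b ^ d \<le> card ?A"
    using card_cells_ge[OF b _ bM, where P = ?P and d = d and B = B] unfolding cube by simp
  then have 2: "real (card ?Z) * real b ^ d \<le> real (card ?A)"
    by (simp flip: of_nat_mult of_nat_power)
  have "real (card ?X) * real b ^ d * (2 ^ R) ^ d \<le> real (card ?Z) * real B ^ d * real b ^ d * (2 ^ R) ^ d"
    using 1 by (intro mult_right_mono) auto
  also have "\<dots> = real (card ?Z) * real b ^ d * (real B * 2 ^ R) ^ d"
    by (simp add: power_mult_distrib)
  also have "\<dots> \<le> real (card ?A) * ((1 + 1 / real d) * (real n * real b)) ^ d"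
    by (intro mult_mono[OF 2] power_mono[OF ratio]) auto
  also have "\<dots> = real (card ?A) * (real n * real b) ^ d * (1 + 1 / real d) ^ d"
    by (simp add: power_mult_distrib)
  also have "\<dots> \<le> real (card ?A) * (real n * real b) ^ d * 3"
  proof (rule mult_left_mono)
    have "(1 + 1 / real d) ^ d \<le> exp (1 / real d) ^ d"
      by (intro power_mono exp_ge_add_one_self) (auto intro: add_nonneg_nonneg)
    also have "\<dots> = exp 1"
      using d by (simp flip: exp_of_nat_mult)
    finally show "(1 + 1 / real d) ^ d \<le> 3" using exp_le by linarith
  qed simp
  finally have "real (card ?X) * 2 ^ (d * R) * real b ^ d \<le> 3 * real (card ?A) * real n ^ d * real b ^ d"
    by (simp add: power_mult_distrib mult_ac flip: power_mult)
  then have "real (card ?X) * 2 ^ (d * R) \<le> 3 * real (card ?A) * real n ^ d"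
    using b by simp
  then show ?thesis
    using n by (simp add: hdist_def card_grid field_simps)
qed

text \<open>The constant \<open>72\<close> ensures \<open>b \<ge> 8 * d\<close>, since \<open>M \<le> 9 k d / \<epsilon>\<close>. Both the uneven last block
  and the rounding in \<open>b\<close> then cost a factor of at most \<open>1 + 1 / (8 d)\<close>.\<close>

lemma discretization_ratio:
  assumes n: "n \<ge> 1" and d: "d \<ge> 1" and k: "k \<ge> 1" and \<epsilon>: "0 < \<epsilon>" "\<epsilon> \<le> 1"
    and R: "72 * real k * (real d)\<^sup>2 / \<epsilon> \<le> 2 ^ R"
  defines "B \<equiv> nat \<lfloor>real n / (8 * real k * real d / \<epsilon>)\<rfloor> + 1"
  defines "M \<equiv> (n - 1) div B + 1"
  defines "b \<equiv> 2 ^ R div M"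
  shows "b \<ge> 1" "b * M \<le> 2 ^ R" "real B * 2 ^ R \<le> (1 + 1 / real d) * (real n * real b)"
proof -
  define y where "y = 8 * real k * real d / \<epsilon>"
  define x where "x = 1 / (8 * real d)"
  have y: "0 < y" using k d \<epsilon> by (simp add: y_def)
  have x: "0 \<le> x" "x \<le> 1 / 8" using d by (simp_all add: x_def)
  have kd: "1 \<le> real k * real d"
    using k d by (metis of_nat_1 of_nat_le_iff of_nat_mult mult_le_mono nat_mult_1)
  have Bp: "B \<ge> 1" by (simp add: B_def)
  have "1 \<le> real k * real d / \<epsilon>" using kd \<epsilon> by (simp add: field_simps)
  moreover have "y = 8 * (real k * real d / \<epsilon>)" by (simp add: y_def)
  ultimately have "real M \<le> 9 * (real k * real d / \<epsilon>)"
    using block_size(2)[OF y n] unfolding M_def B_def y_def[symmetric] by linarith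
  then have "real (8 * d * M) \<le> 8 * real d * (9 * (real k * real d / \<epsilon>))"
    unfolding of_nat_mult by (intro mult_mono) auto
  also have "\<dots> \<le> 2 ^ R" using R by (simp add: power2_eq_square mult_ac)
  finally have "8 * d * M \<le> 2 ^ R" by (metis of_nat_le_iff of_nat_numeral of_nat_power)
  then have "8 * d \<le> b"
    unfolding b_def by (metis M_def add_gr_0 less_eq_div_iff_mult_less_eq zero_less_one)
  then show b: "b \<ge> 1" using d by linarith
  show "b * M \<le> 2 ^ R" by (simp add: b_def)
  have "2 ^ R = b * M + 2 ^ R mod M" by (simp only: b_def div_mult_mod_eq)
  moreover have "2 ^ R mod M < M" by (simp add: M_def)
  ultimately have "2 ^ R \<le> (b + 1) * M" by (simp only: add_mult_distrib)
  then have "real (2 ^ R) \<le> real ((b + 1) * M)" by (simp only: of_nat_le_iff)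
  then have "2 ^ R \<le> (real b + 1) * real M" by (simp only: of_nat_mult of_nat_power of_nat_add of_nat_numeral of_nat_1)
  moreover have "1 \<le> x * real b"
    using \<open>8 * d \<le> b\<close> d by (simp add: x_def field_simps)
  then have "(real b + 1) * real M \<le> ((1 + x) * real b) * real M"
    by (intro mult_right_mono) (simp_all add: distrib_right)
  ultimately have 1: "2 ^ R \<le> ((1 + x) * real b) * real M" by (rule order_trans)
  \<comment> \<open>The \<open>M\<close> full blocks overshoot the grid by at most
    \<open>B - 1\<close>.\<close>
  have "M * B \<le> n + (B - 1)"
    using div_times_less_eq_dividend[of "n - 1" B] n Bp
    unfolding M_def add_mult_distrib by linarith
  then have "real M * real B \<le> real n + real (B - 1)"
    by (simp flip: of_nat_mult of_nat_add)
  also have "real (B - 1) \<le> x * real n"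
  proof -
    have "real (B - 1) \<le> real n / y"
      using block_size(1)[OF y n] unfolding B_def y_def .
    also have "\<dots> = x * real n * (\<epsilon> / real k)"
      by (simp add: y_def x_def)
    also have "\<dots> \<le> x * real n * 1"
      using \<epsilon> k x by (intro mult_left_mono) auto
    finally show ?thesis by simp
  qed
  finally have 2: "real M * real B \<le> (1 + x) * real n"
    by (simp add: algebra_simps)
  have "real B * 2 ^ R \<le> real B * (((1 + x) * real b) * real M)"
    using 1 by (intro mult_left_mono) auto
  also have "\<dots> = ((1 + x) * real b) * (real M * real B)" by simp
  also have "\<dots> \<le> ((1 + x) * real b) * ((1 + x) * real n)"
    using 2 x by (intro mult_left_mono) auto
  also have "\<dots> = (1 + x) * (1 + x) * (real n * real b)" by simp
  also have "\<dots> \<le> (1 + 1 / real d) * (real n * real b)"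
  proof (rule mult_right_mono)
    have "x * x \<le> x * (1 / 8)" using x by (intro mult_left_mono) auto
    then have "(1 + x) * (1 + x) \<le> 1 + 8 * x" using x by (simp add: algebra_simps)
    then show "(1 + x) * (1 + x) \<le> 1 + 1 / real d" by (simp add: x_def)
  qed simp
  finally show "real B * 2 ^ R \<le> (1 + 1 / real d) * (real n * real b)" .
qed

section \<open>The signature of low-degree Fourier coefficients\<close>

lemma tester_low_degree:
  assumes n: "n \<ge> 1" and d: "d \<ge> 1" and k: "k \<ge> 1" and \<epsilon>: "0 < \<epsilon>" "\<epsilon> \<le> 1"
    and R: "72 * real k * (real d)\<^sup>2 / \<epsilon> \<le> 2 ^ R"
    and t: "t \<ge> 1" "48 * real k * sqrt (real (d * R)) / \<epsilon> \<le> real t"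
    and D: "(d * R + 1) ^ t \<le> D"
    and L: "24 * real D / \<epsilon> \<le> real L"
  shows "\<exists>T. is_kmon_tester n d k \<epsilon> T \<and>
             max_queries T (8 * (2 + 3 * real L * real D) / \<epsilon>\<^sup>2 + 1)"
proof -
  define U where "U = {..<d} \<times> {..<R}"
  \<comment> \<open>Rounding both functions then costs \<epsilon>/4, leaving \<epsilon>/4 for the
    Fourier estimate.\<close>
  define y where "y = 8 * real k * real d / \<epsilon>"
  define B where "B = nat \<lfloor>real n / y\<rfloor> + 1"
  define M where "M = (n - 1) div B + 1"
  define b where "b = 2 ^ R div M"
  define pt where "pt A = map (cell B M b) (binary_point d A)" for A
  define lo where "lo = {S. S \<subseteq> U \<and> card S \<le> t}"
  define fc where "fc f = fourier U (\<lambda>A. of_bool (f (pt A)))" for f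
  \<comment> \<open>Coefficients up to degree \<open>t\<close>, rounded to accuracy
    \<open>1 / L\<close>. They lie in [-1, 1], so each has \<open>2 * L + 1\<close> possible
    values.\<close>
  define \<sigma> where "\<sigma> f = restrict (\<lambda>S. \<lfloor>real L * fc f S\<rfloor>) lo" for f
  define V where "V = (lo \<rightarrow>\<^sub>E {- int L..int L})"
  have U: "finite U" "card U = d * R" by (simp_all add: U_def)
  have lo: "finite lo" using U by (simp add: lo_def)
  have "card lo \<le> D"
    using card_subsets_card_le[OF U(1), of t] D unfolding lo_def U(2) by linarith
  have "1 \<le> D" using D by (metis Suc_eq_plus1 Suc_leI le_trans zero_less_Suc zero_less_power One_nat_def)
  then have "1 \<le> 24 * real D / \<epsilon>" using \<epsilon> by (simp add: field_simps)
  with L have L1: "1 \<le> L" by linarith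
  have y: "0 < y" using k d \<epsilon> by (simp add: y_def)
  have B: "B \<ge> 1" by (simp add: B_def)
  note ratio = discretization_ratio[OF n d k \<epsilon> R, folded y_def, folded B_def, folded M_def, folded b_def]
  have pt_grid: "pt A \<in> grid n d" if "A \<subseteq> U" for A
  proof -
    have "binary_point d A \<in> grid (2 ^ R) d"
      using bij_betw_apply[OF bij_betw_binary_point[of d R]] that by (simp add: U_def)
    then show ?thesis
      unfolding pt_def
    proof (rule map_in_grid)
      fix a
      have "min (a div b) (M - 1) < M" by (simp add: M_def)
      then show "cell B M b a < n"
        using corner_lt[OF n] unfolding cell_def M_def by simp
    qed
  qed
  have pt_mono: "coord_le (pt A) (pt A')" if "A \<subseteq> A'" "A' \<subseteq> U" for A A'
    using coord_le_map[OF binary_point_mono mono_cell] that by (simp add: pt_def U_def)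
  have small: "2 * (real k * real d * real (B - 1) / real n) \<le> \<epsilon> / 4"
  proof -
    have "2 * (real k * real d * real (B - 1) / real n) \<le> 2 * (real k * real d * (real n / y) / real n)"
      using block_size(1)[OF y n] unfolding B_def[symmetric]
      by (intro mult_left_mono divide_right_mono) auto
    also have "\<dots> = \<epsilon> / 4"
      using n k d \<epsilon> by (simp add: y_def field_simps)
    finally show ?thesis .
  qed
  show ?thesis
  proof (rule tester_from_signature[OF n \<epsilon>(1)])
    show "finite V" using lo by (simp add: V_def finite_PiE)
    show "\<sigma> f \<in> V" for f
    proof -
      have "\<lfloor>real L * fc f S\<rfloor> \<in> {- int L..int L}" for S
      proof -
        have "\<bar>fc f S\<bar> \<le> 1" unfolding fc_def by (rule abs_fourier_le) (auto simp: U)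
        then have "\<bar>real L * fc f S\<bar> \<le> real L" by (simp add: abs_mult mult_left_le)
        then show ?thesis by (simp add: le_floor_iff floor_le_iff) linarith
      qed
      then show ?thesis by (auto simp: \<sigma>_def V_def)
    qed
    show "hdist n d f g \<le> \<epsilon> / 2"
      if f: "k_monotone n d k f" and g: "k_monotone n d k g" and eq: "\<sigma> f = \<sigma> g" for f g
    proof -
      obtain h1 where h1: "level_function n d k h1" "\<And>x. x \<in> grid n d \<Longrightarrow> f x \<longleftrightarrow> odd (h1 x)"
        using k_monotone_imp_parity[OF f] by blast
      obtain h2 where h2: "level_function n d k h2" "\<And>x. x \<in> grid n d \<Longrightarrow> g x \<longleftrightarrow> odd (h2 x)"
        using k_monotone_imp_parity[OF g] by blast
      have close: "\<bar>fc f S - fc g S\<bar> \<le> 1 / real L" if "S \<subseteq> U" "card S \<le> t" for S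
      proof -
        have "\<lfloor>real L * fc f S\<rfloor> = \<lfloor>real L * fc g S\<rfloor>"
          using fun_cong[OF eq, of S] that by (simp add: \<sigma>_def lo_def)
        then have "\<bar>real L * fc f S - real L * fc g S\<bar> \<le> 1" by linarith
        then have "real L * \<bar>fc f S - fc g S\<bar> \<le> 1"
          by (simp flip: right_diff_distrib add: abs_mult)
        then show ?thesis using L1 by (simp add: field_simps)
      qed
      have "card {A \<in> Pow U. f (pt A) \<noteq> g (pt A)} / 2 ^ card U
              \<le> real (card lo) * (1 / real L)\<^sup>2 + 2 * real k * sqrt (card U) / t"
        unfolding lo_def
      proof (rule parity_disagreement_le[where H = "\<lambda>A. h1 (pt A)" and H' = "\<lambda>A. h2 (pt A)"])
        show "h1 (pt A) \<le> h1 (pt A')" "h2 (pt A) \<le> h2 (pt A')" if "A \<subseteq> A'" "A' \<subseteq> U" for A A'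
          using h1(1) h2(1) pt_mono[OF that] pt_grid that unfolding level_function_def by (meson order_trans)+
        show "h1 (pt A) \<le> k" "h2 (pt A) \<le> k" if "A \<subseteq> U" for A
          using h1(1) h2(1) pt_grid[OF that] by (simp_all add: level_function_def)
      qed (use U t close h1 h2 pt_grid in \<open>simp_all flip: fc_def\<close>)
      \<comment> \<open>One factor \<open>1 / L\<close> compensates the at most \<open>D\<close>
        coefficients; the other is simply bounded by 1.\<close>
      also have "real (card lo) * (1 / real L)\<^sup>2 \<le> \<epsilon> / 24"
      proof -
        have "real (card lo) * (1 / real L)\<^sup>2 = real (card lo) / real L / real L"
          by (simp add: power2_eq_square)
        also have "\<dots> \<le> real D / real L / real L"
          using \<open>card lo \<le> D\<close> by (intro divide_right_mono) auto
        also have "\<dots> \<le> real D / real L / 1"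
          using L1 by (intro divide_left_mono) auto
        also have "\<dots> \<le> \<epsilon> / 24"
          using L L1 \<epsilon> by (simp add: field_simps)
        finally show ?thesis .
      qed
      also have "2 * real k * sqrt (card U) / t \<le> \<epsilon> / 24"
        using t \<epsilon> by (simp add: U(2) field_simps)
      \<comment> \<open>Low and high degrees contribute \<epsilon>/24 each; the factor 3 lost
        between cube and grid turns the sum \<epsilon>/12 into \<epsilon>/4.\<close>
      finally have "card {A \<in> Pow U. f (pt A) \<noteq> g (pt A)} / 2 ^ (d * R) \<le> \<epsilon> / 12"
        by (simp add: U(2))
      then have "hdist n d (f \<circ> round_down B) (g \<circ> round_down B) \<le> \<epsilon> / 4"
        using hdist_round_down_le_cube[OF n B ratio(1) ratio(2)[unfolded M_def] ratio(3) d, of f g]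
        unfolding M_def[symmetric] pt_def U_def by linarith
      with hdist_via_round_down[OF f g B n] small show ?thesis by linarith
    qed
    have "card V = (2 * L + 1) ^ card lo"
      using lo by (simp add: V_def card_PiE nat_add_distrib nat_mult_distrib)
    also have "\<dots> \<le> (3 * L) ^ card lo"
      using L1 by (intro power_mono) auto
    also have "\<dots> \<le> (3 * L) ^ D"
      using L1 \<open>card lo \<le> D\<close> by (intro power_increasing) auto
    finally have "real (card V) \<le> (3 * real L) ^ D"
      by (metis of_nat_le_iff of_nat_mult of_nat_numeral of_nat_power)
    moreover have "real (card V) > 0"
      using \<open>card V = (2 * L + 1) ^ card lo\<close> by simp
    ultimately have "ln (3 * real (card V)) \<le> ln (3 * (3 * real L) ^ D)"
      by (intro ln_mono) auto
    also have "\<dots> = ln 3 + real D * ln (3 * real L)"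
      using L1 by (simp add: ln_mult ln_realpow distrib_left)
    \<comment> \<open>Replacing the logarithm by its argument is crude but harmless: polynomial
      factors in \<open>D\<close> only change a constant in the final exponent.\<close>
    also have "\<dots> \<le> 2 + real D * (3 * real L)"
      using ln_le_minus_one[of "3::real"] ln_le_minus_one[of "3 * real L"] L1
      by (intro add_mono mult_left_mono) auto
    finally show "8 * ln (3 * real (card V)) / \<epsilon>\<^sup>2 + 1 \<le> 8 * (2 + 3 * real L * real D) / \<epsilon>\<^sup>2 + 1"
      by (intro add_mono divide_right_mono mult_left_mono) (simp_all add: mult_ac)
  qed
qed

section \<open>Choice of the parameters for the second bound\<close>

lemma of_nat_ceiling_le: "0 \<le> (x::real) \<Longrightarrow> real (nat \<lceil>x\<rceil>) \<le> x + 1"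
  by linarith

lemma tester_subexponential:
  assumes n: "n \<ge> 1" and d: "d \<ge> 1" and k: "k \<ge> 1" and \<epsilon>: "0 < \<epsilon>" "\<epsilon> \<le> 1"
  shows "\<exists>T. is_kmon_tester n d k \<epsilon> T \<and>
             max_queries T (2 powr (2400 * (real k * sqrt (real d) / \<epsilon>\<^sup>2) *
                                    (log 2 (2 + real k * sqrt (real d) / \<epsilon>\<^sup>2))\<^sup>2))"
proof -
  \<comment> \<open>Each of \<open>k\<close>, \<open>sqrt d\<close>, \<open>1 / \<epsilon>\<close>
    and \<open>1 / \<epsilon>\<^sup>2\<close> is at most \<open>s\<close>, so everything can be
    bounded in \<open>s\<close> alone.\<close>
  define s where "s = real k * sqrt (real d) / \<epsilon>\<^sup>2"
  define l where "l = log 2 (2 + s)"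
  have "\<epsilon>\<^sup>2 \<le> 1" "\<epsilon>\<^sup>2 > 0" using \<epsilon> by (simp_all add: power_le_one)
  have sd: "sqrt (real d) \<ge> 1" using d by simp
  have "1 \<le> real k" using k by simp
  have "real k * 1 \<le> real k * sqrt (real d)" using sd by (intro mult_left_mono) auto
  also have ksd: "\<dots> \<le> s"
    unfolding s_def using \<open>\<epsilon>\<^sup>2 \<le> 1\<close> \<open>\<epsilon>\<^sup>2 > 0\<close> by (simp add: le_divide_eq mult_left_le)
  finally have ks: "real k \<le> s" by simp
  have s1: "1 \<le> s" using ks k by linarith
  have "1 * sqrt (real d) \<le> real k * sqrt (real d)" using k by (intro mult_right_mono) auto
  with ksd have "sqrt (real d) \<le> s" by simp
  then have ds: "real d \<le> s\<^sup>2" by (metis real_sqrt_le_iff real_sqrt_unique s1 order_trans zero_le_one real_sqrt_abs abs_of_nonneg)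
  have "1 * 1 \<le> real k * sqrt (real d)" using sd \<open>1 \<le> real k\<close> by (intro mult_mono) auto
  then have e2: "1 / \<epsilon>\<^sup>2 \<le> s"
    unfolding s_def using \<open>\<epsilon>\<^sup>2 > 0\<close> by (intro divide_right_mono) auto
  have "\<epsilon>\<^sup>2 \<le> \<epsilon>" using \<epsilon> by (simp add: power2_eq_square mult_left_le)
  then have e1: "1 / \<epsilon> \<le> s"
    using e2 \<epsilon> by (meson divide_left_mono \<open>\<epsilon>\<^sup>2 > 0\<close> mult_pos_pos order_trans zero_le_one)
  \<comment> \<open>Powers of \<sigma> are exponentials in \<open>l\<close>, and \<sigma> is at
    least 3, so constants can be absorbed into powers of \<sigma>.\<close>
  define \<sigma> where "\<sigma> = 2 + s"
  have \<sigma>: "\<sigma> \<ge> 3" "s \<le> \<sigma>" using s1 by (simp_all add: \<sigma>_def)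
  have pl: "2 powr l = \<sigma>" using s1 by (simp add: l_def \<sigma>_def)
  have l1: "1 \<le> l" using s1 by (simp add: l_def le_log_iff)
  have l\<sigma>: "l \<le> 2 * \<sigma>"
  proof -
    have "1 / 2 \<le> ln (2::real)" using ln_le_minus_one[of "1 / 2 :: real"] by (simp add: ln_div)
    moreover have "ln \<sigma> \<le> \<sigma>" using ln_le_minus_one[of \<sigma>] \<sigma> by simp
    moreover have "\<sigma> * (1 / 2) \<le> \<sigma> * ln 2" using calculation \<sigma> by (intro mult_left_mono) auto
    ultimately have "ln \<sigma> \<le> 2 * \<sigma> * ln 2" by linarith
    then show ?thesis by (simp add: l_def \<sigma>_def[symmetric] log_def divide_le_eq)
  qed
  have \<sigma>pow: "\<sigma> ^ m = 2 powr (real m * l)" for m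
    by (simp add: pl[symmetric] powr_powr mult.commute flip: powr_realpow)
  \<comment> \<open>The lower bound needed for \<open>2 ^ R\<close> is at most
    \<open>72 * \<sigma> ^ 6\<close>, and 72 is below \<open>3 ^ 4\<close>; hence
    \<open>\<sigma> ^ 10 = 2 powr (10 * l)\<close> suffices.\<close>
  define R where "R = nat \<lceil>10 * l\<rceil>"
  define t where "t = nat \<lceil>48 * real k * sqrt (real (d * R)) / \<epsilon>\<rceil>"
  define D where "D = (d * R + 1) ^ t"
  define L where "L = nat \<lceil>24 * real D / \<epsilon>\<rceil>"
  have Rl: "10 * l \<le> real R" "real R \<le> 11 * l" "R \<ge> 1" using l1 unfolding R_def by linarith+
  have R: "72 * real k * (real d)\<^sup>2 / \<epsilon> \<le> 2 ^ R"
  proof -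
    have "72 * real k * (real d)\<^sup>2 / \<epsilon> = 72 * (real k * ((real d)\<^sup>2 * (1 / \<epsilon>)))" by simp
    also have "\<dots> \<le> 72 * (\<sigma> * ((\<sigma>\<^sup>2)\<^sup>2 * \<sigma>))"
    proof -
      have "s\<^sup>2 \<le> \<sigma>\<^sup>2" using s1 \<sigma> by (intro power_mono) auto
      then have "real d \<le> \<sigma>\<^sup>2" using ds by linarith
      then show ?thesis
        using ks e1 s1 \<epsilon> \<sigma> by (intro mult_mono power_mono) auto
    qed
    also have "\<dots> = 72 * \<sigma> ^ 6" by (simp add: power2_eq_square power_numeral_reduce)
    also have "\<dots> \<le> \<sigma> ^ 4 * \<sigma> ^ 6"
      using power_mono[OF \<sigma>(1), of 4] \<sigma> by (intro mult_right_mono) auto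
    also have "\<dots> = 2 powr (real 10 * l)"
      unfolding \<sigma>pow[symmetric] by (simp flip: power_add)
    also have "\<dots> \<le> 2 powr real R" using Rl by simp
    also have "\<dots> = 2 ^ R" by (simp add: powr_realpow)
    finally show ?thesis .
  qed
  have t: "t \<ge> 1" "48 * real k * sqrt (real (d * R)) / \<epsilon> \<le> real t" "real t \<le> 193 * s * l"
  proof -
    have pos: "48 * real k * sqrt (real (d * R)) / \<epsilon> > 0" using k d Rl \<epsilon> by simp
    then show "t \<ge> 1" "48 * real k * sqrt (real (d * R)) / \<epsilon> \<le> real t"
      unfolding t_def by linarith+
    \<comment> \<open>The root of \<open>R\<close> is of order \<open>sqrt l\<close>; the cruder
      bound \<open>4 * l\<close> keeps the exponent of the logarithm an integer.\<close>
    have "l * 1 \<le> l * l" using l1 by (intro mult_left_mono) auto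
    then have "real R \<le> 16 * (l * l)" using Rl by linarith
    also have "16 * (l * l) = (4 * l)\<^sup>2" by (simp add: power2_eq_square)
    finally have "sqrt (real R) \<le> sqrt ((4 * l)\<^sup>2)" by (rule real_sqrt_le_mono)
    also have "sqrt ((4 * l)\<^sup>2) = 4 * l" using l1 by (intro real_sqrt_unique) auto
    finally have "sqrt (real R) \<le> 4 * l" .
    moreover have "real k * sqrt (real d) / \<epsilon> \<le> s"
      unfolding s_def using \<open>\<epsilon>\<^sup>2 \<le> \<epsilon>\<close> \<epsilon>(1) by (intro divide_left_mono) auto
    ultimately have "real k * sqrt (real d) / \<epsilon> * sqrt (real R) \<le> s * (4 * l)"
      using s1 by (intro mult_mono) auto
    then have "48 * real k * sqrt (real (d * R)) / \<epsilon> \<le> 192 * s * l"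
      by (simp add: real_sqrt_mult)
    moreover have "1 * 1 \<le> s * l" using s1 l1 by (intro mult_mono) auto
    ultimately show "real t \<le> 193 * s * l"
      using of_nat_ceiling_le[OF less_imp_le[OF pos]] unfolding t_def[symmetric] by simp
  qed
  have DL: "1 \<le> real D" "real D \<le> 2 powr (1158 * s * l\<^sup>2)"
  proof -
    show "1 \<le> real D" by (simp add: D_def)
    \<comment> \<open>Bounding the base of \<open>D\<close> by \<open>\<sigma> ^ 6\<close> and
      \<open>t\<close> by \<open>193 * s * l\<close> gives the constant
      \<open>1158 = 6 * 193\<close>.\<close>
    have "real (d * R + 1) \<le> \<sigma>\<^sup>2 * (11 * (2 * \<sigma>)) + 1"
    proof -
      have "s\<^sup>2 \<le> \<sigma>\<^sup>2" using s1 \<sigma> by (intro power_mono) auto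
      then have "real d * real R \<le> \<sigma>\<^sup>2 * (11 * (2 * \<sigma>))"
        using ds Rl l\<sigma> by (intro mult_mono) auto
      then show ?thesis by simp
    qed
    also have "\<dots> = 22 * \<sigma> ^ 3 + 1" by (simp add: power2_eq_square power3_eq_cube)
    also have "\<dots> \<le> \<sigma> ^ 3 * \<sigma> ^ 3"
    proof -
      have "27 \<le> \<sigma> ^ 3" using power_mono[OF \<sigma>(1), of 3] by simp
      moreover from this have "27 * \<sigma> ^ 3 \<le> \<sigma> ^ 3 * \<sigma> ^ 3" using \<sigma> by (intro mult_right_mono) auto
      ultimately show ?thesis by linarith
    qed
    also have "\<dots> = 2 powr (real 6 * l)" unfolding \<sigma>pow[symmetric] by (simp flip: power_add)
    finally have "real D \<le> (2 powr (real 6 * l)) ^ t"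
      unfolding D_def of_nat_power by (intro power_mono) auto
    also have "\<dots> = 2 powr (6 * l * real t)"
      by (simp add: powr_powr flip: powr_realpow)
    also have "\<dots> \<le> 2 powr (6 * l * (193 * s * l))"
      using t(3) l1 by (intro powr_mono mult_left_mono) auto
    also have "6 * l * (193 * s * l) = 1158 * s * l\<^sup>2" by (simp add: power2_eq_square)
    finally show "real D \<le> 2 powr (1158 * s * l\<^sup>2)" .
  qed
  have L: "24 * real D / \<epsilon> \<le> real L" "real L \<le> 25 * real D / \<epsilon>"
  proof -
    show "24 * real D / \<epsilon> \<le> real L" unfolding L_def by linarith
    have "1 \<le> real D / \<epsilon>" using DL \<epsilon> by (simp add: field_simps)
    moreover have "0 \<le> real D / \<epsilon>" using \<epsilon> by simp
    moreover have "24 * real D / \<epsilon> = 24 * (real D / \<epsilon>)" "25 * real D / \<epsilon> = 25 * (real D / \<epsilon>)" by simp_all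
    ultimately show "real L \<le> 25 * real D / \<epsilon>"
      using of_nat_ceiling_le[of "24 * real D / \<epsilon>"] unfolding L_def[symmetric] by linarith
  qed
  \<comment> \<open>As \<open>L\<close> is of order \<open>D / \<epsilon>\<close>, the two factors
    \<open>D\<close> contribute \<open>2 * 1158 = 2316\<close> to the exponent; the slack up to 2400
    absorbs the constant 617 and the factor \<open>1 / \<epsilon> ^ 3\<close>.\<close>
  have "8 * (2 + 3 * real L * real D) / \<epsilon>\<^sup>2 + 1 \<le> 2 powr (2400 * s * l\<^sup>2)"
  proof -
    have "1 * 1 \<le> (real D)\<^sup>2 * (1 / \<epsilon>)" using DL \<epsilon> by (intro mult_mono) auto
    then have D1: "1 \<le> (real D)\<^sup>2 / \<epsilon>" by simp
    have e: "1 \<le> 1 / \<epsilon>\<^sup>2" using \<open>\<epsilon>\<^sup>2 \<le> 1\<close> \<open>\<epsilon>\<^sup>2 > 0\<close> by simp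
    have "real L * real D \<le> 25 * real D / \<epsilon> * real D"
      using L by (intro mult_right_mono) auto
    then have "8 * (2 + 3 * real L * real D) \<le> 616 * ((real D)\<^sup>2 / \<epsilon>)"
      using D1 by (simp add: power2_eq_square)
    then have "8 * (2 + 3 * real L * real D) * (1 / \<epsilon>\<^sup>2) \<le> 616 * ((real D)\<^sup>2 / \<epsilon>) * (1 / \<epsilon>\<^sup>2)"
      by (intro mult_right_mono) auto
    moreover have "1 * 1 \<le> ((real D)\<^sup>2 / \<epsilon>) * (1 / \<epsilon>\<^sup>2)" using D1 e by (intro mult_mono) auto
    ultimately have "8 * (2 + 3 * real L * real D) / \<epsilon>\<^sup>2 + 1 \<le> 617 * (((real D)\<^sup>2 / \<epsilon>) * (1 / \<epsilon>\<^sup>2))"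
      by simp
    also have "\<dots> = 617 * ((real D)\<^sup>2 * (1 / \<epsilon> * (1 / \<epsilon>\<^sup>2)))" by simp
    also have "\<dots> \<le> 2 ^ 10 * ((2 powr (1158 * s * l\<^sup>2))\<^sup>2 * (\<sigma> * \<sigma>))"
      using DL e1 e2 s1 \<sigma> \<epsilon> by (intro mult_mono power_mono) auto
    also have "\<sigma> * \<sigma> = 2 powr (2 * l)" using \<sigma>pow[of 2] by (simp add: power2_eq_square)
    also have "(2 powr (1158 * s * l\<^sup>2))\<^sup>2 = 2 powr (2316 * s * l\<^sup>2)"
      by (simp add: powr_power mult.assoc)
    also have "(2::real) ^ 10 = 2 powr 10" by (simp add: powr_numeral)
    also have "2 powr 10 * (2 powr (2316 * s * l\<^sup>2) * 2 powr (2 * l)) =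
               2 powr (10 + (2316 * (s * l\<^sup>2) + 2 * l))"
      by (simp add: powr_add mult.assoc)
    also have "\<dots> \<le> 2 powr (2400 * s * l\<^sup>2)"
    proof -
      have "l * 1 \<le> l * l" using l1 by (intro mult_left_mono) auto
      moreover have "1 * l\<^sup>2 \<le> s * l\<^sup>2" using s1 by (intro mult_right_mono) auto
      ultimately have "l \<le> s * l\<^sup>2" by (simp add: power2_eq_square)
      then have "10 + (2316 * (s * l\<^sup>2) + 2 * l) \<le> 2400 * (s * l\<^sup>2)" using l1 by linarith
      then show ?thesis by (intro powr_mono) (simp_all add: mult.assoc)
    qed
    finally show ?thesis .
  qed
  moreover obtain T where "is_kmon_tester n d k \<epsilon> T"
    "max_queries T (8 * (2 + 3 * real L * real D) / \<epsilon>\<^sup>2 + 1)"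
    using tester_low_degree[OF n d k \<epsilon> R t(1,2) _ L(1)] by (auto simp: D_def)
  ultimately show ?thesis
    unfolding max_queries_def s_def[symmetric] l_def[symmetric] by (fastforce intro: order_trans)
qed

theorem theorem1p7:
  shows "\<exists>(C1::real) (c1::nat) (C2::real) (c2::nat).
    \<forall>(n::nat) (d::nat) (k::nat) (\<epsilon>::real).
      n \<ge> 1 \<longrightarrow> d \<ge> 1 \<longrightarrow> k \<ge> 1 \<longrightarrow> 0 < \<epsilon> \<longrightarrow> \<epsilon> \<le> 1 \<longrightarrow>
      (\<exists>T. is_kmon_tester n d k \<epsilon> T \<and>
        max_queries T
          (min (soft_O C1 c1 ((1 / \<epsilon>\<^sup>2) * (5 * real k * real d / \<epsilon>) ^ d))
               (2 powr (soft_O C2 c2 (real k * sqrt (real d) / \<epsilon>\<^sup>2)))))"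
\<comment> \<open>The first bound needs no logarithm. In the second, one logarithm comes from the
  degree \<open>t\<close> and one from the base of \<open>D\<close>.\<close>
proof (rule exI[of _ 25], rule exI[of _ 0], rule exI[of _ 2400], rule exI[of _ 2], intro allI impI)
  fix n d k :: nat and \<epsilon> :: real
  assume *: "n \<ge> 1" "d \<ge> 1" "k \<ge> 1" "0 < \<epsilon>" "\<epsilon> \<le> 1"
  let ?q1 = "soft_O 25 0 ((1 / \<epsilon>\<^sup>2) * (5 * real k * real d / \<epsilon>) ^ d)"
  let ?q2 = "2 powr (soft_O 2400 2 (real k * sqrt (real d) / \<epsilon>\<^sup>2))"
  show "\<exists>T. is_kmon_tester n d k \<epsilon> T \<and> max_queries T (min ?q1 ?q2)"
  \<comment> \<open>All parameters are fixed before the tester is chosen, so the one with the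
    smaller bound can be taken.\<close>
  proof (cases "?q1 \<le> ?q2")
    case True
    then show ?thesis using tester_brute_force[OF *] by (simp add: soft_O_def min_def)
  next
    case False
    then show ?thesis using tester_subexponential[OF *] by (simp add: soft_O_def min_def)
  qed
qed

end
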